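(* Let $X$ and $Y$ be Banach lattices such that $X$ has the W1 property and $Y$ is order continuous. Let $S,T\colon X\to Y$ be linear operators with $0\le S\le T$. If $T$ is weakly Banach-Saks, then $S$ is weakly Banach-Saks.
   Context: A Banach lattice $X$ has the W1 property if for every relatively weakly compact set $A\subseteq X$, the set $\{|a|: a\in A\}$ is relatively weakly compact. A Banach lattice is order continuous if $x_\alpha\downarrow 0$ implies $\|x_\alpha\|\to 0$ for every net. $0\le S\le T$ means $0\le Sx\le Tx$ for all $x\in X_+$. An operator $T\colon X\to Y$ is weakly Banach-Saks if for every weakly null sequence $(x_n)$ in $X$, $(Tx_n)$ has a subsequence $(y_n)$ whose Cesàro means $\frac1n\sum_{k=1}^n y_k$ converge in norm. *)

theory Defs
  imports "HOL-Analysis.Analysis" "HOL-Library.Lattice_Algebras"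
begin

text \<open>
  The class \<open>lattice_ab_group_add_abs\<close> fixes the modulus by \<open>\<bar>x\<bar> = sup x (- x)\<close>.
\<close>

class banach_lattice = banach + ordered_real_vector + lattice_ab_group_add_abs +
  assumes norm_abs_mono: "\<bar>x\<bar> \<le> \<bar>y\<bar> \<Longrightarrow> norm x \<le> norm y"

instance real :: banach_lattice
  by standard (simp_all add: sup_real_def max_def abs_if)

definition weak_topology :: "'a::real_normed_vector topology" where
  "weak_topology = topology_generated_by
     {f -` U | (f :: 'a \<Rightarrow> real) U. bounded_linear f \<and> open U}"

lemma topspace_weak_topology [simp]:
  "topspace (weak_topology :: 'a::real_normed_vector topology) = UNIV"
proof -
  have "UNIV \<in> {f -` U | (f :: 'a \<Rightarrow> real) U. bounded_linear f \<and> open U}"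
    using bounded_linear_zero by (intro CollectI exI[of _ "\<lambda>_. 0"] exI[of _ UNIV]) auto
  then show ?thesis
    unfolding weak_topology_def topology_generated_by_topspace by blast
qed

lemma limitin_weak_topology_iff:
  fixes x :: "nat \<Rightarrow> 'a::real_normed_vector"
  shows "limitin weak_topology x l sequentially \<longleftrightarrow>
    (\<forall>f :: 'a \<Rightarrow> real. bounded_linear f \<longrightarrow> (\<lambda>n. f (x n)) \<longlonglongrightarrow> f l)"
proof
  assume L: "limitin weak_topology x l sequentially"
  show "\<forall>f :: 'a \<Rightarrow> real. bounded_linear f \<longrightarrow> (\<lambda>n. f (x n)) \<longlonglongrightarrow> f l"
  proof (intro allI impI topological_tendstoI)
    fix f :: "'a \<Rightarrow> real" and U :: "real set"
    assume f: "bounded_linear f" and U: "open U" "f l \<in> U"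
    have "openin weak_topology (f -` U)"
      unfolding weak_topology_def using f U by (intro topology_generated_by_Basis) blast
    then show "\<forall>\<^sub>F n in sequentially. f (x n) \<in> U"
      using L U unfolding limitin_def by auto
  qed
next
  assume R: "\<forall>f :: 'a \<Rightarrow> real. bounded_linear f \<longrightarrow> (\<lambda>n. f (x n)) \<longlonglongrightarrow> f l"
  have "l \<in> V \<longrightarrow> (\<forall>\<^sub>F n in sequentially. x n \<in> V)"
    if "generate_topology_on {f -` U | (f :: 'a \<Rightarrow> real) U. bounded_linear f \<and> open U} V" for V
    using that
  proof (induction rule: generate_topology_on.induct)
    case Empty
    show ?case by simp
  next
    case (Int a b)
    then show ?case by (auto intro: eventually_conj)
  next
    case (UN K)
    show ?case
    proof
      assume "l \<in> \<Union>K"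
      then obtain k where k: "k \<in> K" "l \<in> k" by blast
      with UN have "\<forall>\<^sub>F n in sequentially. x n \<in> k" by blast
      then show "\<forall>\<^sub>F n in sequentially. x n \<in> \<Union>K"
        by (rule eventually_mono) (use k in blast)
    qed
  next
    case (Basis s)
    then obtain f U where "s = f -` U" "bounded_linear (f :: 'a \<Rightarrow> real)" "open U" by blast
    then show ?case using R topological_tendstoD by fastforce
  qed
  then have "\<forall>V. openin weak_topology V \<and> l \<in> V \<longrightarrow> (\<forall>\<^sub>F n in sequentially. x n \<in> V)"
    unfolding weak_topology_def openin_topology_generated_by_iff by blast
  then show "limitin weak_topology x l sequentially"
    by (simp add: limitin_def)
qed

definition relatively_weakly_compact :: "'a::real_normed_vector set \<Rightarrow> bool" where
  "relatively_weakly_compact A \<longleftrightarrow> compactin weak_topology (weak_topology closure_of A)"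

definition W1_property :: "'a::banach_lattice itself \<Rightarrow> bool" where
  "W1_property _ \<longleftrightarrow>
     (\<forall>A :: 'a set. relatively_weakly_compact A \<longrightarrow> relatively_weakly_compact (abs ` A))"

definition directed_preorder :: "'i set \<Rightarrow> ('i \<Rightarrow> 'i \<Rightarrow> bool) \<Rightarrow> bool" where
  "directed_preorder I le \<longleftrightarrow>
     I \<noteq> {} \<and>
     (\<forall>i\<in>I. le i i) \<and>
     (\<forall>i\<in>I. \<forall>j\<in>I. \<forall>k\<in>I. le i j \<longrightarrow> le j k \<longrightarrow> le i k) \<and>
     (\<forall>i\<in>I. \<forall>j\<in>I. \<exists>k\<in>I. le i k \<and> le j k)"

text \<open>\<open>x\<^sub>i \<down> 0\<close>: the net is decreasing and its infimum exists and equals \<open>0\<close>.\<close>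

definition net_decreases_to_zero ::
  "'i set \<Rightarrow> ('i \<Rightarrow> 'i \<Rightarrow> bool) \<Rightarrow> ('i \<Rightarrow> 'a::banach_lattice) \<Rightarrow> bool" where
  "net_decreases_to_zero I le x \<longleftrightarrow>
     (\<forall>i\<in>I. \<forall>j\<in>I. le i j \<longrightarrow> x j \<le> x i) \<and>
     (\<forall>i\<in>I. 0 \<le> x i) \<and>
     (\<forall>z. (\<forall>i\<in>I. z \<le> x i) \<longrightarrow> z \<le> 0)"

definition net_norm_null ::
  "'i set \<Rightarrow> ('i \<Rightarrow> 'i \<Rightarrow> bool) \<Rightarrow> ('i \<Rightarrow> 'a::real_normed_vector) \<Rightarrow> bool" where
  "net_norm_null I le x \<longleftrightarrow> (\<forall>e>0. \<exists>i\<in>I. \<forall>j\<in>I. le i j \<longrightarrow> norm (x j) < e)"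

text \<open>
  A definition cannot quantify over all index types, so the nets here are indexed by directed
  preorders on subsets of the space itself. This is no restriction: \<open>order_continuousD\<close> below
  derives the property for nets over an arbitrary index type.
\<close>

definition order_continuous :: "'a::banach_lattice itself \<Rightarrow> bool" where
  "order_continuous _ \<longleftrightarrow>
     (\<forall>(I :: 'a set) le (x :: 'a \<Rightarrow> 'a).
        directed_preorder I le \<longrightarrow> net_decreases_to_zero I le x \<longrightarrow> net_norm_null I le x)"

lemma order_continuousD:
  fixes x :: "'i \<Rightarrow> 'a::banach_lattice"
  assumes oc: "order_continuous TYPE('a)"
    and dir: "directed_preorder I le"
    and dec: "net_decreases_to_zero I le x"
  shows "net_norm_null I le x"
proof -
  let ?ge = "\<lambda>u v :: 'a. v \<le> u"
  have "directed_preorder (x ` I) ?ge"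
    unfolding directed_preorder_def
  proof (intro conjI ballI)
    show "x ` I \<noteq> {}" using dir by (auto simp: directed_preorder_def)
    fix u v assume "u \<in> x ` I" "v \<in> x ` I"
    then obtain i j where ij: "i \<in> I" "j \<in> I" "u = x i" "v = x j" by blast
    obtain k where "k \<in> I" "le i k" "le j k"
      using dir ij unfolding directed_preorder_def by blast
    then show "\<exists>w\<in>x ` I. w \<le> u \<and> w \<le> v"
      using dec ij unfolding net_decreases_to_zero_def by blast
  qed auto
  moreover have "net_decreases_to_zero (x ` I) ?ge (\<lambda>u. u)"
    using dec by (auto simp: net_decreases_to_zero_def)
  ultimately have N: "net_norm_null (x ` I) ?ge (\<lambda>u. u)"
    using oc unfolding order_continuous_def by blast
  show ?thesis
    unfolding net_norm_null_def
  proof (intro allI impI)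
    fix e :: real assume "e > 0"
    then obtain i where i: "i \<in> I" "\<forall>j\<in>I. x j \<le> x i \<longrightarrow> norm (x j) < e"
      using N unfolding net_norm_null_def by blast
    then show "\<exists>i\<in>I. \<forall>j\<in>I. le i j \<longrightarrow> norm (x j) < e"
      using dec unfolding net_decreases_to_zero_def by blast
  qed
qed

text \<open>
  Sequences start at \<open>0\<close>, so \<open>y\<^sub>1, \<dots>, y\<^sub>n\<close> becomes \<open>T (x (r 0)), \<dots>, T (x (r (n - 1)))\<close>.
\<close>

definition weakly_Banach_Saks ::
  "('a::real_normed_vector \<Rightarrow> 'b::real_normed_vector) \<Rightarrow> bool" where
  "weakly_Banach_Saks T \<longleftrightarrow>
     (\<forall>x. limitin weak_topology x 0 sequentially \<longrightarrow>
        (\<exists>r :: nat \<Rightarrow> nat. strict_mono r \<and>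
           convergent (\<lambda>n. (1 / real n) *\<^sub>R (\<Sum>k<n. T (x (r k))))))"

end

theory Submission
  imports Defs "HOL-Library.Diagonal_Subsequence"
begin

text \<open>
  Let \<open>x\<^sub>n\<close> be weakly null. By the W1 property and the Eberlein--Smulian theorem, \<open>\<bar>x\<^sub>n\<bar>\<close> converges
  weakly to some \<open>z\<close> along a subsequence. As \<open>Y\<close> is order continuous, there is a positive functional
  \<open>f\<close> whose smallness on \<open>[0, T z]\<close> forces smallness of the norm. The positive functional \<open>\<theta> = f \<circ> T\<close>
  turns \<open>X\<close> into an \<open>L\<^sup>1\<close>-like space with seminorm \<open>\<theta> \<bar>x\<bar>\<close>, and an abstract version of Szlenk's theorem
  gives a subsequence all of whose further subsequences have Cesaro means \<open>t\<^sub>n\<close> with \<open>\<theta> \<bar>t\<^sub>n\<bar> \<rightarrow> 0\<close>.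
  Applying the hypothesis on \<open>T\<close> to \<open>\<bar>x\<^sub>n\<bar> - z\<close> bounds \<open>\<bar>S t\<^sub>n\<bar>\<close> by \<open>T z\<close> up to a norm null sequence, and
  \<open>f \<bar>S t\<^sub>n\<bar> \<le> \<theta> \<bar>t\<^sub>n\<bar> \<rightarrow> 0\<close> then yields \<open>\<parallel>S t\<^sub>n\<parallel> \<rightarrow> 0\<close>.

  Szlenk's theorem is proved without representing \<open>X\<close> as a function space: a convex functional built
  from the terms \<open>\<theta> ((\<bar>x\<bar> - i w)\<^sup>+)\<close> plays the role of the Huber function, and the next term of the subsequence
  is chosen so that the subgradients at the finitely many relevant partial sums are small on it.
\<close>

section \<open>The Hahn--Banach theorem\<close>

definition sublinear :: "('a::real_vector \<Rightarrow> real) \<Rightarrow> bool" where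
  "sublinear p \<longleftrightarrow> (\<forall>x y. p (x + y) \<le> p x + p y) \<and> (\<forall>x. \<forall>t\<ge>0. p (t *\<^sub>R x) = t * p x)"

lemma sublinear_0: "sublinear p \<Longrightarrow> p 0 = 0"
  unfolding sublinear_def by (metis mult_zero_left order_refl scaleR_zero_left)

lemma sublinear_minus: "sublinear p \<Longrightarrow> - p (- x) \<le> p x"
  using sublinear_0[of p] unfolding sublinear_def
  by (metis add.right_inverse minus_le_iff diff_ge_0_iff_ge diff_minus_eq_add)

text \<open>Supplies the bounds for Zorn's lemma. Every \<open>q\<close> in \<open>C\<close>
  satisfies \<open>- p (- x) \<le> - q (- x) \<le> q x\<close>, so the infimum is finite;
  subadditivity survives because two members of a chain can be replaced by the smaller one.\<close>

lemma sublinear_Inf_chain: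
  fixes C :: "('a::real_vector \<Rightarrow> real) set"
  assumes C: "C \<noteq> {}" "\<And>q. q \<in> C \<Longrightarrow> sublinear q" "\<And>q x. q \<in> C \<Longrightarrow> q x \<le> p x"
    and chain: "\<And>q r. q \<in> C \<Longrightarrow> r \<in> C \<Longrightarrow> q \<le> r \<or> r \<le> q"
  shows "sublinear (\<lambda>x. INF q\<in>C. q x)" and "\<And>q x. q \<in> C \<Longrightarrow> (INF q\<in>C. q x) \<le> q x"
proof -
  have bdd: "bdd_below ((\<lambda>q. q x) ` C)" for x
  proof (rule bdd_belowI2)
    fix q assume "q \<in> C"
    then show "- p (- x) \<le> q x"
      using C(3)[of q "- x"] sublinear_minus[OF C(2), of q x] by linarith
  qed
  show le: "(INF q\<in>C. q x) \<le> q x" if "q \<in> C" for q x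
    using bdd that by (rule cINF_lower)
  show "sublinear (\<lambda>x. INF q\<in>C. q x)"
    unfolding sublinear_def
  proof (intro conjI allI impI)
    fix x y
    have "(INF q\<in>C. q (x + y)) - q x \<le> r y" if qr: "q \<in> C" "r \<in> C" for q r
    proof -
      obtain s where s: "s \<in> C" "s \<le> q" "s \<le> r"
        using chain[OF qr] qr by blast
      have "(INF q\<in>C. q (x + y)) \<le> s (x + y)" by (rule le) fact
      also have "\<dots> \<le> s x + s y" using C(2)[OF s(1)] by (simp add: sublinear_def)
      finally show ?thesis using le_funD[OF s(2), of x] le_funD[OF s(3), of y] by linarith
    qed
    then have "(INF q\<in>C. q (x + y)) - q x \<le> (INF q\<in>C. q y)" if "q \<in> C" for q
      using that C(1) by (intro cINF_greatest) auto
    then have "(INF q\<in>C. q (x + y)) - (INF q\<in>C. q y) \<le> (INF q\<in>C. q x)"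
      using C(1) by (intro cINF_greatest) (auto simp: algebra_simps)
    then show "(INF q\<in>C. q (x + y)) \<le> (INF q\<in>C. q x) + (INF q\<in>C. q y)"
      by simp
  next
    fix x and t :: real assume t: "0 \<le> t"
    have "(INF q\<in>C. q (t *\<^sub>R x)) = (INF q\<in>C. t * q x)"
      using C(2) t by (intro INF_cong) (auto simp: sublinear_def)
    also have "\<dots> = t * (INF q\<in>C. q x)"
    proof (cases "t = 0")
      case True
      then show ?thesis using C(1) by simp
    next
      case False
      with t have t: "t > 0" by simp
      show ?thesis
      proof (rule antisym)
        have "(INF q\<in>C. t * q x) / t \<le> (INF q\<in>C. q x)"
        proof (intro cINF_greatest C(1))
          fix q assume q: "q \<in> C"
          have "bdd_below ((\<lambda>q. t * q x) ` C)"
            using bdd_belowI2[of C "t * (INF q\<in>C. q x)" "\<lambda>q. t * q x"] le t by simp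
          then have "(INF q\<in>C. t * q x) \<le> t * q x" using q by (rule cINF_lower)
          then show "(INF q\<in>C. t * q x) / t \<le> q x" using t by (simp add: field_simps)
        qed
        then show "(INF q\<in>C. t * q x) \<le> t * (INF q\<in>C. q x)" using t by (simp add: field_simps)
        show "t * (INF q\<in>C. q x) \<le> (INF q\<in>C. t * q x)"
          using le t C(1) by (intro cINF_greatest) auto
      qed
    qed
    finally show "(INF q\<in>C. q (t *\<^sub>R x)) = t * (INF q\<in>C. q x)" .
  qed
qed

text \<open>Hence a minimal sublinear \<open>q\<close> satisfies \<open>q (- v) = - q v\<close>.\<close>

lemma sublinear_lower:
  fixes q :: "'a::real_vector \<Rightarrow> real" and v :: 'a
  assumes q: "sublinear q"
  defines "r \<equiv> \<lambda>x. INF t\<in>{0..}. q (x + t *\<^sub>R v) - t * q v"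
  shows "sublinear r" and "r x \<le> q x" and "r (- v) \<le> - q v"
proof -
  have sub: "q (x + y) \<le> q x + q y" and hom: "t \<ge> 0 \<Longrightarrow> q (t *\<^sub>R x) = t * q x" for x y t
    using q by (auto simp: sublinear_def)
  have bdd: "bdd_below ((\<lambda>t. q (x + t *\<^sub>R v) - t * q v) ` {0..})" for x
  proof (rule bdd_belowI2)
    fix t :: real assume "t \<in> {0..}"
    then have "t * q v \<le> q (x + t *\<^sub>R v) + q (- x)"
      using sub[of "x + t *\<^sub>R v" "- x"] hom[of t v] by simp
    then show "- q (- x) \<le> q (x + t *\<^sub>R v) - t * q v" by simp
  qed
  have le: "r x \<le> q (x + t *\<^sub>R v) - t * q v" if "t \<ge> 0" for x t
    unfolding r_def using bdd by (rule cINF_lower) (use that in simp)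
  show "r x \<le> q x" using le[of 0 x] by simp
  show "r (- v) \<le> - q v" using le[of 1 "- v"] sublinear_0[OF q] by simp
  show "sublinear r"
    unfolding sublinear_def
  proof (intro conjI allI impI)
    fix x y
    have "r (x + y) - (q (x + s *\<^sub>R v) - s * q v) \<le> q (y + t *\<^sub>R v) - t * q v"
      if "s \<ge> 0" "t \<ge> 0" for s t
      using le[of "s + t" "x + y"] that sub[of "x + s *\<^sub>R v" "y + t *\<^sub>R v"]
      by (simp add: algebra_simps)
    then have "r (x + y) - (q (x + s *\<^sub>R v) - s * q v) \<le> r y" if "s \<ge> 0" for s
      using that by (subst (2) r_def, intro cINF_greatest) auto
    then have "r (x + y) - r y \<le> q (x + s *\<^sub>R v) - s * q v" if "s \<ge> 0" for s
      using that by (simp add: algebra_simps)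
    then have "r (x + y) - r y \<le> r x"
      by (subst (3) r_def, intro cINF_greatest) auto
    then show "r (x + y) \<le> r x + r y" by simp
  next
    fix x and t :: real assume t: "0 \<le> t"
    have r0: "r 0 = 0"
    proof (rule antisym)
      show "r 0 \<le> 0" using le[of 0 0] sublinear_0[OF q] by simp
      show "0 \<le> r 0" unfolding r_def by (intro cINF_greatest) (auto simp: hom)
    qed
    have ge: "r (t *\<^sub>R x) \<le> t * r x" if t: "t > 0" for t x
    proof -
      have "r (t *\<^sub>R x) / t \<le> q (x + s *\<^sub>R v) - s * q v" if "s \<ge> 0" for s
        using le[of "t * s" "t *\<^sub>R x"] hom[of t "x + s *\<^sub>R v"] t that
        by (simp add: field_simps scaleR_add_right)
      then have "r (t *\<^sub>R x) / t \<le> r x"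
        by (subst (2) r_def, intro cINF_greatest) auto
      then show ?thesis using t by (simp add: field_simps)
    qed
    show "r (t *\<^sub>R x) = t * r x"
    proof (cases "t = 0")
      case False
      with t have "t > 0" by simp
      then show ?thesis using ge[of t x] ge[of "1 / t" "t *\<^sub>R x"] by (simp add: field_simps)
    qed (simp add: r0)
  qed
qed

text \<open>Lowering a minimal sublinear functional in the direction \<open>v\<close> gives a
  sublinear functional again, so minimality forces it to be odd, and an odd sublinear functional is
  linear.\<close>

theorem sublinear_dominates_linear:
  fixes p :: "'a::real_vector \<Rightarrow> real"
  assumes p: "sublinear p"
  obtains f where "linear f" "\<And>x. f x \<le> p x"
proof -
  let ?A = "{q. sublinear q \<and> q \<le> p}"
  \<comment> \<open>The order is reversed below, so that the maximal element of Zorn's lemma is a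
    minimal functional.\<close>
  have "\<exists>m\<in>?A. \<forall>q\<in>?A. q \<le> m \<longrightarrow> q = m"
  proof (rule predicate_Zorn)
    show "partial_order_on ?A (relation_of (\<lambda>q r. r \<le> q) ?A)"
      by (rule partial_order_on_relation_ofI) auto
    fix C assume "C \<in> Chains (relation_of (\<lambda>q r. r \<le> q) ?A)"
    then have C: "\<And>q r. q \<in> C \<Longrightarrow> r \<in> C \<Longrightarrow> q \<le> r \<or> r \<le> q" and CA: "C \<subseteq> ?A"
      unfolding Chains_def relation_of_def by blast+
    show "\<exists>u\<in>?A. \<forall>a\<in>C. u \<le> a"
    proof (cases "C = {}")
      case False
      have I: "sublinear (\<lambda>x. INF q\<in>C. q x)" "\<And>q x. q \<in> C \<Longrightarrow> (INF q\<in>C. q x) \<le> q x"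
        by (rule sublinear_Inf_chain[where p = p]; use False CA C in \<open>auto simp: le_fun_def\<close>)+
      have lep: "q x \<le> p x" if "q \<in> C" for q x
        using CA that by (auto simp: le_fun_def)
      obtain q where "q \<in> C" using False by blast
      then have "(INF q\<in>C. q x) \<le> p x" for x
        using I(2)[of q x] lep[of q x] by linarith
      then show ?thesis
        using I by (intro bexI[of _ "\<lambda>x. INF q\<in>C. q x"]) (auto simp: le_fun_def)
    qed (use p in auto)
  qed
  then obtain m where m: "sublinear m" "m \<le> p"
    and min: "\<And>q. sublinear q \<Longrightarrow> q \<le> m \<Longrightarrow> q = m"
    by (metis (mono_tags, lifting) mem_Collect_eq order_trans)
  have neg: "m (- v) = - m v" for v
  proof -
    define r where "r x = (INF t\<in>{0..}. m (x + t *\<^sub>R v) - t * m v)" for x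
    have "r = m"
      using sublinear_lower(1,2)[OF m(1), where v = v, folded r_def]
      by (intro min) (auto simp: le_fun_def)
    then have "m (- v) \<le> - m v"
      using sublinear_lower(3)[OF m(1), of v, folded r_def] by simp
    then show ?thesis using sublinear_minus[OF m(1), of v] by simp
  qed
  have sub: "m (x + y) \<le> m x + m y" and hom: "t \<ge> 0 \<Longrightarrow> m (t *\<^sub>R x) = t * m x" for x y t
    using m(1) by (auto simp: sublinear_def)
  have "linear m"
  proof (rule linearI)
    show "m (x + y) = m x + m y" for x y
      using sub[of x y] sub[of "- x" "- y"] neg[of x] neg[of y] neg[of "x + y"] by simp
    show "m (t *\<^sub>R x) = t *\<^sub>R m x" for t x
      using hom[of t x] hom[of "- t" x] neg[of "t *\<^sub>R x"] by (cases "t \<ge> 0") auto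
  qed
  with m(2) show thesis by (intro that) (auto simp: le_fun_def)
qed

text \<open>
  The subgradient is a linear functional below the directional derivative of \<open>J\<close> at \<open>a\<close>.
\<close>

theorem convex_subgradient:
  fixes J :: "'a::real_normed_vector \<Rightarrow> real"
  assumes convex: "convex_on UNIV J"
    and lip: "\<And>x y. J (x + y) \<le> J x + L * norm y"
  obtains g where "bounded_linear g" "\<And>y. g y \<le> J (a + y) - J a"
proof -
  define D where "D t y = (J (a + t *\<^sub>R y) - J a) / t" for t y
  \<comment> \<open>By convexity this is the right directional derivative; written as an infimum, it
    is handled without monotonicity of the quotients.\<close>
  define p where "p y = (INF t\<in>{0<..}. D t y)" for y
  have lower: "- (L * norm y) \<le> D t y" if "t > 0" for t y
    using lip[of "a + t *\<^sub>R y" "- (t *\<^sub>R y)"] that by (simp add: D_def field_simps)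
  have bdd: "bdd_below ((\<lambda>t. D t y) ` {0<..})" for y
    by (rule bdd_belowI2[of _ "- (L * norm y)"]) (use lower in auto)
  have le: "p y \<le> D t y" if "t > 0" for t y
    unfolding p_def using bdd by (rule cINF_lower) (use that in simp)
  have ge: "c \<le> p y" if "\<And>t. t > 0 \<Longrightarrow> c \<le> D t y" for c y
    unfolding p_def by (rule cINF_greatest) (use that in auto)
  have "sublinear p"
    unfolding sublinear_def
  proof (intro conjI allI impI)
    fix x y
    have "p (x + y) \<le> D s x + D t y" if st: "s > 0" "t > 0" for s t
    proof -
      \<comment> \<open>With this step length, \<open>a + r (x + y)\<close> is the convex
        combination of \<open>a + s x\<close> and \<open>a + t y\<close> with weights
        \<open>u\<close> and \<open>v\<close>, since \<open>r = u s = v t\<close>.\<close>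
      define r where "r = s * t / (s + t)"
      have r: "r > 0" using st by (simp add: r_def)
      define u v where "u = t / (s + t)" and "v = s / (s + t)"
      have uv: "u \<ge> 0" "v \<ge> 0" "u + v = 1"
        using st by (simp_all add: u_def v_def add.commute flip: add_divide_distrib)
      have rs: "r = u * s" "r = v * t"
        by (simp_all add: r_def u_def v_def)
      have "a + r *\<^sub>R (x + y) = (u + v) *\<^sub>R a + r *\<^sub>R x + r *\<^sub>R y"
        by (simp add: uv scaleR_add_right)
      also have "\<dots> = u *\<^sub>R (a + s *\<^sub>R x) + v *\<^sub>R (a + t *\<^sub>R y)"
        by (simp add: scaleR_add_right scaleR_add_left flip: rs)
      finally have "J (a + r *\<^sub>R (x + y)) \<le> u * J (a + s *\<^sub>R x) + v * J (a + t *\<^sub>R y)"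
        using convex uv unfolding convex_on_def by simp
      also have "\<dots> = u * (s * D s x) + v * (t * D t y) + (u + v) * J a"
      proof -
        have "J (a + s *\<^sub>R x) = J a + s * D s x" "J (a + t *\<^sub>R y) = J a + t * D t y"
          using st by (simp_all add: D_def)
        then show ?thesis by (simp only:) (simp add: algebra_simps)
      qed
      also have "\<dots> = r * (D s x + D t y) + J a"
        using uv rs by (simp add: algebra_simps)
      finally have "D r (x + y) \<le> D s x + D t y"
        using r uv by (simp add: D_def[of r] field_simps)
      then show ?thesis using le[OF r, of "x + y"] by simp
    qed
    then have "p (x + y) - D s x \<le> D t y" if "s > 0" "t > 0" for s t
      using that by (simp add: diff_le_eq add.commute)
    then have "p (x + y) - D s x \<le> p y" if "s > 0" for s
      using that by (intro ge)
    then have "p (x + y) - p y \<le> D s x" if "s > 0" for s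
      using that by (simp add: diff_le_eq add.commute)
    then have "p (x + y) - p y \<le> p x"
      by (intro ge)
    then show "p (x + y) \<le> p x + p y" by simp
  next
    fix x and t :: real assume "0 \<le> t"
    have p0: "p 0 = 0"
      using le[of 1 0] ge[of 0 0] by (auto simp: D_def)
    have ge': "p (t *\<^sub>R x) \<le> t * p x" if t: "t > 0" for t x
    proof -
      have "p (t *\<^sub>R x) / t \<le> p x"
      proof (rule ge)
        fix s :: real assume "s > 0"
        then show "p (t *\<^sub>R x) / t \<le> D s x"
          using le[of "s / t" "t *\<^sub>R x"] t by (simp add: D_def field_simps)
      qed
      then show ?thesis using t by (simp add: field_simps)
    qed
    show "p (t *\<^sub>R x) = t * p x"
    proof (cases "t = 0")
      case False
      with \<open>0 \<le> t\<close> have "t > 0" by simp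
      then show ?thesis using ge'[of t x] ge'[of "1 / t" "t *\<^sub>R x"] by (simp add: field_simps)
    qed (simp add: p0)
  qed
  then obtain g where g: "linear g" "\<And>y. g y \<le> p y"
    using sublinear_dominates_linear by blast
  have gJ: "g y \<le> J (a + y) - J a" for y
    using g(2)[of y] le[of 1 y] by (simp add: D_def)
  have le: "g y \<le> L * norm y" for y
    using gJ[of y] lip[of a y] by simp
  have "norm (g y) \<le> norm y * L" for y
    using le[of y] le[of "- y"] linear_neg[OF g(1), of y] by (simp add: abs_le_iff mult.commute)
  then have "bounded_linear g"
    using g(1) by (intro bounded_linear_intro[of g L]) (simp_all add: linear_add linear_scale)
  with gJ show thesis by (rule that[rotated])
qed

section \<open>The weak topology\<close>

text \<open>Averaging points \<open>a\<close> and \<open>b\<close> of \<open>C\<close> with the same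
  weights gives a competitor in \<open>C\<close>. The infima over \<open>b\<close> and
  \<open>a\<close> are then taken one after the other.\<close>

lemma convex_on_infdist:
  fixes C :: "'a::real_normed_vector set"
  assumes C: "convex C" "C \<noteq> {}"
  shows "convex_on UNIV (\<lambda>x. infdist x C)"
proof (rule convex_onI)
  fix t :: real and x y :: 'a
  assume t: "0 < t" "t < 1"
  have "infdist ((1 - t) *\<^sub>R x + t *\<^sub>R y) C \<le> (1 - t) * dist x a + t * dist y b"
    if "a \<in> C" "b \<in> C" for a b
  proof -
    have "(1 - t) *\<^sub>R a + t *\<^sub>R b \<in> C"
      using C that t by (intro convexD) auto
    then have "infdist ((1 - t) *\<^sub>R x + t *\<^sub>R y) C \<le>
        dist ((1 - t) *\<^sub>R x + t *\<^sub>R y) ((1 - t) *\<^sub>R a + t *\<^sub>R b)"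
      by (rule infdist_le)
    also have "\<dots> = norm ((1 - t) *\<^sub>R (x - a) + t *\<^sub>R (y - b))"
      by (simp add: dist_norm algebra_simps)
    also have "\<dots> \<le> (1 - t) * dist x a + t * dist y b"
      using norm_triangle_ineq[of "(1 - t) *\<^sub>R (x - a)" "t *\<^sub>R (y - b)"] t by (simp add: dist_norm)
    finally show ?thesis .
  qed
  then have "(infdist ((1 - t) *\<^sub>R x + t *\<^sub>R y) C - (1 - t) * dist x a) / t \<le> dist y b"
    if "a \<in> C" "b \<in> C" for a b
    using that t by (simp add: field_simps)
  then have "(infdist ((1 - t) *\<^sub>R x + t *\<^sub>R y) C - (1 - t) * dist x a) / t \<le> infdist y C"
    if "a \<in> C" for a
    unfolding infdist_notempty[OF C(2), of y] using that C(2) by (intro cINF_greatest)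
  then have "(infdist ((1 - t) *\<^sub>R x + t *\<^sub>R y) C - t * infdist y C) / (1 - t) \<le> dist x a"
    if "a \<in> C" for a
    using that t by (simp add: field_simps)
  then have "(infdist ((1 - t) *\<^sub>R x + t *\<^sub>R y) C - t * infdist y C) / (1 - t) \<le> infdist x C"
    unfolding infdist_notempty[OF C(2), of x] using C(2) by (intro cINF_greatest)
  then show "infdist ((1 - t) *\<^sub>R x + t *\<^sub>R y) C \<le> (1 - t) * infdist x C + t * infdist y C"
    using t by (simp add: field_simps)
qed auto

text \<open>\<open>g\<close> is a subgradient at \<open>z\<close> of the distance to
  \<open>C\<close>. Moving from \<open>z\<close> into \<open>C\<close> lowers the distance from
  \<open>infdist z C\<close> to 0, so \<open>g\<close> drops by at least that amount.\<close>

lemma separating_functional: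
  fixes C :: "'a::real_normed_vector set"
  assumes "convex C" "C \<noteq> {}" "z \<notin> closure C"
  obtains g :: "'a \<Rightarrow> real" and d where "bounded_linear g" "d > 0" "\<And>c. c \<in> C \<Longrightarrow> g c \<le> g z - d"
proof -
  have "infdist (x + y) C \<le> infdist x C + 1 * norm y" for x y
    using infdist_triangle[of "x + y" C x] by (simp add: dist_norm)
  then obtain g where g: "bounded_linear g" "\<And>y. g y \<le> infdist (z + y) C - infdist z C"
    using convex_subgradient[OF convex_on_infdist[OF assms(1,2)]] by blast
  show thesis
  proof (rule that[of g "infdist z C"])
    show "bounded_linear g" by fact
    show "infdist z C > 0"
      using assms in_closure_iff_infdist_zero infdist_nonneg by (metis less_eq_real_def)
    fix c assume "c \<in> C"
    then show "g c \<le> g z - infdist z C"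
      using g(2)[of "c - z"] by (simp add: linear_diff bounded_linear.linear[OF g(1)])
  qed
qed

lemma convex_on_norm: "convex_on UNIV (norm :: 'a::real_normed_vector \<Rightarrow> real)"
proof (rule convex_onI)
  fix t :: real and x y :: 'a assume "0 < t" "t < 1"
  then show "norm ((1 - t) *\<^sub>R x + t *\<^sub>R y) \<le> (1 - t) * norm x + t * norm y"
    using norm_triangle_ineq[of "(1 - t) *\<^sub>R x" "t *\<^sub>R y"] by simp
qed auto

text \<open>A subgradient of the norm at \<open>x\<close> is bounded by the norm, by the triangle
  inequality; testing it on \<open>- x\<close> gives \<open>norm x \<le> g x\<close>.\<close>

lemma norming_functional:
  fixes x :: "'a::real_normed_vector"
  obtains g :: "'a \<Rightarrow> real" where "bounded_linear g" "g x = norm x" "\<And>y. \<bar>g y\<bar> \<le> norm y"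
proof -
  have "norm (a + y) \<le> norm a + 1 * norm y" for a y :: 'a
    using norm_triangle_ineq[of a y] by simp
  then obtain g where g: "bounded_linear g" "\<And>y. g y \<le> norm (x + y) - norm x"
    using convex_subgradient[OF convex_on_norm] by blast
  interpret bounded_linear g by fact
  have le: "g y \<le> norm y" for y
    using g(2)[of y] norm_triangle_ineq[of x y] by simp
  then have "\<bar>g y\<bar> \<le> norm y" for y
    using le[of y] le[of "- y"] by (simp add: neg abs_le_iff)
  moreover have "g x = norm x"
    using le[of x] g(2)[of "- x"] by (simp add: neg)
  ultimately show thesis using that g(1) by blast
qed

lemma weakly_separated:
  fixes x y :: "'a::real_normed_vector"
  assumes "\<And>f :: 'a \<Rightarrow> real. bounded_linear f \<Longrightarrow> f x = f y"
  shows "x = y"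
proof -
  obtain g where g: "bounded_linear g" "g (x - y) = norm (x - y)"
    using norming_functional by metis
  then show ?thesis
    using assms[OF g(1)] by (simp add: linear_diff bounded_linear.linear)
qed

lemma openin_weak_topology_vimage:
  "bounded_linear (f :: 'a::real_normed_vector \<Rightarrow> real) \<Longrightarrow> open U \<Longrightarrow> openin weak_topology (f -` U)"
  unfolding weak_topology_def by (intro topology_generated_by_Basis) blast

lemma Hausdorff_weak_topology: "Hausdorff_space (weak_topology :: 'a::real_normed_vector topology)"
  unfolding Hausdorff_space_def
proof (intro allI impI)
  fix x y :: 'a assume "x \<in> topspace weak_topology \<and> y \<in> topspace weak_topology \<and> x \<noteq> y"
  then obtain f :: "'a \<Rightarrow> real" where f: "bounded_linear f" "f x \<noteq> f y"
    using weakly_separated by blast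
  obtain U V where UV: "open U" "open V" "f x \<in> U" "f y \<in> V" "U \<inter> V = {}"
    using hausdorff[OF f(2)] by metis
  then show "\<exists>U V. openin weak_topology U \<and> openin weak_topology V \<and> x \<in> U \<and> y \<in> V \<and> disjnt U V"
  proof (intro exI conjI)
    show "openin weak_topology (f -` U)" "openin weak_topology (f -` V)"
      using f UV by (simp_all add: openin_weak_topology_vimage)
    show "x \<in> f -` U" "y \<in> f -` V" using UV by simp_all
    show "disjnt (f -` U) (f -` V)"
      unfolding disjnt_def using UV(5) by blast
  qed
qed

text \<open>The range together with the limit is compact: a member of the cover around
  \<open>l\<close> contains all but finitely many terms. As the space is Hausdorff, this set is
  closed and contains the weak closure.\<close>

lemma relatively_weakly_compact_range:
  fixes x :: "nat \<Rightarrow> 'a::real_normed_vector"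
  assumes x: "limitin weak_topology x l sequentially"
  shows "relatively_weakly_compact (range x)"
proof -
  let ?K = "insert l (range x)"
  have K: "compactin weak_topology ?K"
    unfolding compactin_def
  proof (intro conjI allI impI)
    fix \<U> assume U: "(\<forall>U\<in>\<U>. openin weak_topology U) \<and> ?K \<subseteq> \<Union>\<U>"
    then obtain V where V: "V \<in> \<U>" "l \<in> V" by blast
    with U x have "\<forall>\<^sub>F n in sequentially. x n \<in> V" unfolding limitin_def by blast
    then obtain N where N: "\<And>n. n \<ge> N \<Longrightarrow> x n \<in> V" unfolding eventually_sequentially by blast
    from U have "\<forall>n. \<exists>W\<in>\<U>. x n \<in> W" by blast
    then obtain W where W: "\<And>n. W n \<in> \<U>" "\<And>n. x n \<in> W n" by metis
    have "x n \<in> \<Union>(insert V (W ` {..<N}))" for n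
      using N[of n] W(2)[of n] by (cases "n < N") auto
    with V have "?K \<subseteq> \<Union>(insert V (W ` {..<N}))" by blast
    then show "\<exists>\<F>. finite \<F> \<and> \<F> \<subseteq> \<U> \<and> ?K \<subseteq> \<Union>\<F>"
      using V W by (intro exI[of _ "insert V (W ` {..<N})"]) auto
  qed auto
  have "weak_topology closure_of range x \<subseteq> ?K"
    using compactin_imp_closedin[OF Hausdorff_weak_topology K] by (intro closure_of_minimal) auto
  then show ?thesis
    unfolding relatively_weakly_compact_def using K by (metis closed_compactin closedin_closure_of)
qed

section \<open>Countable rational spans and their closures\<close>

text \<open>Rational combinations of \<open>u 0, ..., u (n - 1)\<close>. Adding one vector at a time
  makes countability and the rational vector space laws simple inductions.\<close>

primrec rat_span :: "(nat \<Rightarrow> 'a::real_vector) \<Rightarrow> nat \<Rightarrow> 'a set" where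
  "rat_span u 0 = {0}"
| "rat_span u (Suc n) = (\<lambda>(d, q :: rat). d + of_rat q *\<^sub>R u n) ` (rat_span u n \<times> UNIV)"

lemma countable_rat_span: "countable (rat_span u n)"
proof (induction n)
  case (Suc n)
  then show ?case
    unfolding rat_span.simps by (intro countable_image countable_SIGMA) simp_all
qed simp

lemma rat_span_Suc_I: "d \<in> rat_span u n \<Longrightarrow> d + of_rat q *\<^sub>R u n \<in> rat_span u (Suc n)"
  unfolding rat_span.simps by (rule image_eqI[of _ _ "(d, q)"]) simp_all

lemma rat_span_Suc_E:
  assumes "d \<in> rat_span u (Suc n)"
  obtains d' q where "d = d' + of_rat q *\<^sub>R u n" "d' \<in> rat_span u n"
proof -
  from assms obtain p where "p \<in> rat_span u n \<times> UNIV" "d = (case p of (d, q) \<Rightarrow> d + of_rat q *\<^sub>R u n)"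
    unfolding rat_span.simps by (rule imageE)
  then show thesis by (cases p) (auto intro: that)
qed

lemma rat_span_mono: "m \<le> n \<Longrightarrow> rat_span u m \<subseteq> rat_span u n"
proof (induction n rule: dec_induct)
  case (step n)
  have "d \<in> rat_span u (Suc n)" if "d \<in> rat_span u n" for d
    using rat_span_Suc_I[OF that, of 0] by simp
  with step show ?case by blast
qed (rule subset_refl)

lemma rat_span_add: "d \<in> rat_span u n \<Longrightarrow> e \<in> rat_span u n \<Longrightarrow> d + e \<in> rat_span u n"
proof (induction n arbitrary: d e)
  case (Suc n)
  obtain d' q where d: "d = d' + of_rat q *\<^sub>R u n" "d' \<in> rat_span u n"
    using Suc.prems(1) by (rule rat_span_Suc_E)
  obtain e' r where e: "e = e' + of_rat r *\<^sub>R u n" "e' \<in> rat_span u n"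
    using Suc.prems(2) by (rule rat_span_Suc_E)
  have "d + e = (d' + e') + of_rat (q + r) *\<^sub>R u n"
    by (simp add: d e of_rat_add scaleR_add_left)
  then show ?case using rat_span_Suc_I[OF Suc.IH[OF d(2) e(2)]] by simp
qed simp

lemma rat_span_scale: "d \<in> rat_span u n \<Longrightarrow> of_rat q *\<^sub>R d \<in> rat_span u n"
proof (induction n arbitrary: d)
  case (Suc n)
  obtain d' r where d: "d = d' + of_rat r *\<^sub>R u n" "d' \<in> rat_span u n"
    using Suc.prems by (rule rat_span_Suc_E)
  have "of_rat q *\<^sub>R d = of_rat q *\<^sub>R d' + of_rat (q * r) *\<^sub>R u n"
    by (simp add: d of_rat_mult scaleR_add_right)
  then show ?case using rat_span_Suc_I[OF Suc.IH[OF d(2)]] by simp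
qed simp

lemma subspace_closure_rat_span:
  fixes u :: "nat \<Rightarrow> 'a::real_normed_vector"
  shows "subspace (closure (\<Union>n. rat_span u n))"
proof -
  let ?D = "\<Union>n. rat_span u n"
  have add: "d + e \<in> ?D" if "d \<in> ?D" "e \<in> ?D" for d e
  proof -
    obtain m n where "d \<in> rat_span u m" "e \<in> rat_span u n" using \<open>d \<in> ?D\<close> \<open>e \<in> ?D\<close> by blast
    then have "d \<in> rat_span u (max m n)" "e \<in> rat_span u (max m n)"
      using rat_span_mono[of m "max m n" u] rat_span_mono[of n "max m n" u] by auto
    then show ?thesis using rat_span_add by blast
  qed
  have scale: "of_rat q *\<^sub>R d \<in> ?D" if "d \<in> ?D" for q d
    using that rat_span_scale by blast
  show ?thesis
  proof (rule subspaceI)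
    have "0 \<in> ?D" by (rule UN_I[of 0]) simp_all
    then show "0 \<in> closure ?D" using closure_subset by (rule subsetD[rotated])
  next
    fix x y assume "x \<in> closure ?D" "y \<in> closure ?D"
    then obtain f g where fg: "\<And>n. f n \<in> ?D" "f \<longlonglongrightarrow> x" "\<And>n. g n \<in> ?D" "g \<longlonglongrightarrow> y"
      unfolding closure_sequential by metis
    have "(\<lambda>n. f n + g n) \<longlonglongrightarrow> x + y" by (intro tendsto_add fg)
    moreover have "\<forall>n. f n + g n \<in> ?D" using add fg by metis
    ultimately show "x + y \<in> closure ?D"
      unfolding closure_sequential by (intro exI[of _ "\<lambda>n. f n + g n"] conjI)
  next
    fix c :: real and x assume "x \<in> closure ?D"
    then obtain f where f: "\<And>n. f n \<in> ?D" "f \<longlonglongrightarrow> x"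
      unfolding closure_sequential by metis
    have "c \<in> closure \<rat>" by (simp add: Rats_closure_real)
    then obtain r where r: "\<And>n. r n \<in> \<rat>" "r \<longlonglongrightarrow> c"
      unfolding closure_sequential by metis
    have "(\<lambda>n. r n *\<^sub>R f n) \<longlonglongrightarrow> c *\<^sub>R x" by (intro tendsto_scaleR r f)
    moreover have "r n *\<^sub>R f n \<in> ?D" for n
    proof -
      obtain q where "r n = of_rat q" using r(1)[of n] by (rule Rats_cases)
      then show ?thesis using scale[OF f(1)[of n], of q] by (simp only:)
    qed
    ultimately show "c *\<^sub>R x \<in> closure ?D"
      unfolding closure_sequential by (intro exI[of _ "\<lambda>n. r n *\<^sub>R f n"] conjI allI)
  qed
qed

lemma in_rat_span: "u k \<in> rat_span u (Suc k)"
proof -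
  have "0 \<in> rat_span u k" using rat_span_mono[of 0 k u] by simp
  from rat_span_Suc_I[OF this, of 1] show ?thesis by (simp del: rat_span.simps)
qed

section \<open>The Eberlein--Smulian theorem\<close>

text \<open>Without a cluster point, every point of \<open>K\<close> has a neighbourhood that the
  sequence eventually avoids. Finitely many of these cover \<open>K\<close>, so the sequence would
  eventually leave \<open>K\<close>.\<close>

lemma compactin_cluster_point:
  assumes K: "compactin X K" and v: "\<And>n. v n \<in> K"
  obtains z where "z \<in> K" "\<And>V. openin X V \<Longrightarrow> z \<in> V \<Longrightarrow> \<exists>\<^sub>F n in sequentially. v n \<in> V"
proof (rule ccontr)
  assume "\<not> thesis"
  then have "\<forall>z\<in>K. \<exists>V. openin X V \<and> z \<in> V \<and> (\<forall>\<^sub>F n in sequentially. v n \<notin> V)"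
    using that unfolding frequently_def by metis
  then obtain V where V: "\<And>z. z \<in> K \<Longrightarrow> openin X (V z)" "\<And>z. z \<in> K \<Longrightarrow> z \<in> V z"
    "\<And>z. z \<in> K \<Longrightarrow> \<forall>\<^sub>F n in sequentially. v n \<notin> V z"
    by metis
  have "(\<forall>U\<in>V ` K. openin X U) \<and> K \<subseteq> \<Union>(V ` K)" using V by blast
  then obtain \<F> where F: "finite \<F>" "\<F> \<subseteq> V ` K" "K \<subseteq> \<Union>\<F>"
    using K unfolding compactin_def by meson
  have "\<forall>\<^sub>F n in sequentially. \<forall>U\<in>\<F>. v n \<notin> U"
    using F V(3) by (intro eventually_ball_finite) auto
  moreover have "\<not> (\<forall>U\<in>\<F>. v n \<notin> U)" for n
    using F(3) v[of n] by blast
  ultimately show False by simp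
qed

text \<open>
  Along a diagonal subsequence every functional of a countable family norming the closed span
  converges; two weak cluster points of it then agree on that family, so they are equal.
\<close>

theorem relatively_weakly_compact_subsequence:
  fixes u :: "nat \<Rightarrow> 'a::real_normed_vector"
  assumes rwc: "relatively_weakly_compact (range u)"
  obtains r z where "strict_mono r" "limitin weak_topology (u \<circ> r) z sequentially"
proof -
  define K where "K = weak_topology closure_of range u"
  have K: "compactin weak_topology K" using rwc by (simp add: K_def relatively_weakly_compact_def)
  have uK: "u n \<in> K" for n
    unfolding K_def by (rule subsetD[OF closure_of_subset]) simp_all
  \<comment> \<open>The image of the weakly compact \<open>K\<close> is compact; the resulting bound
    feeds Bolzano--Weierstrass in the diagonal argument.\<close>
  have bounded: "bounded (range (\<lambda>n. f (u n)))" if "bounded_linear f" for f :: "'a \<Rightarrow> real"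
  proof -
    have "continuous_map weak_topology euclideanreal f"
      unfolding continuous_map_def
      using openin_weak_topology_vimage[OF that] by (simp add: vimage_def)
    then have "compactin euclideanreal (f ` K)" using K by (rule image_compactin[rotated])
    then have "bounded (f ` K)" by (simp add: compact_imp_bounded)
    then show ?thesis by (rule bounded_subset) (use uK in blast)
  qed
  define D where "D = (\<Union>n. rat_span u n)"
  have "countable D"
    unfolding D_def by (intro countable_UN countable_rat_span) simp
  moreover have uD: "u k \<in> D" for k
    unfolding D_def using in_rat_span[of u k] by (rule UN_I[OF UNIV_I])
  then have "D \<noteq> {}" by (auto simp only: empty_iff)
  ultimately have d: "range (from_nat_into D) = D"
    by (intro range_from_nat_into)
  define d where "d = from_nat_into D"
  note d = d[folded d_def]
  have "\<exists>g. bounded_linear g \<and> g (d i) = norm (d i) \<and> (\<forall>y. \<bar>g y\<bar> \<le> norm y)" for i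
    by (rule norming_functional[of "d i"]) blast
  then obtain g where g: "\<And>i. bounded_linear (g i)" "\<And>i. g i (d i) = norm (d i)"
    "\<And>i y. \<bar>g i y\<bar> \<le> norm y"
    by metis
  interpret subseqs "\<lambda>i s. convergent (\<lambda>k. g i (u (s k)))"
  proof
    fix i and s :: "nat \<Rightarrow> nat" assume "strict_mono s"
    have "bounded (range (\<lambda>k. g i (u (s k))))"
      using bounded[OF g(1)] by (rule bounded_subset) blast
    from bounded_imp_convergent_subsequence[OF this]
    show "\<exists>r'. strict_mono r' \<and> convergent (\<lambda>k. g i (u ((s \<circ> r') k)))"
      unfolding convergent_def o_def by metis
  qed
  define r where "r = diagseq"
  have r: "strict_mono r" unfolding r_def by (rule subseq_diagseq)
  have conv: "convergent (\<lambda>k. g i (u (r k)))" for i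
  proof -
    have "convergent (\<lambda>k. g i (u ((diagseq \<circ> (+) (Suc i)) k)))"
    proof (rule diagseq_holds)
      fix q s :: "nat \<Rightarrow> nat" and n
      assume "strict_mono q" "convergent (\<lambda>k. g n (u (s k)))"
      then show "convergent (\<lambda>k. g n (u ((s \<circ> q) k)))"
        using convergent_subseq_convergent[of "\<lambda>k. g n (u (s k))" q] by (simp add: o_def)
    qed
    then have "convergent (\<lambda>k. g i (u (diagseq (k + Suc i))))"
      by (simp add: o_def add.commute)
    then show ?thesis
      unfolding r_def by (rule iffD1[OF convergent_ignore_initial_segment])
  qed
  have frequent: "\<exists>\<^sub>F n in sequentially. f (v n) \<in> U"
    if "\<And>V. openin weak_topology V \<Longrightarrow> z \<in> V \<Longrightarrow> \<exists>\<^sub>F n in sequentially. v n \<in> V"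
      "bounded_linear f" "open U" "f z \<in> U" for v z U and f :: "'a \<Rightarrow> real"
    using that(1)[OF openin_weak_topology_vimage[OF that(2,3)]] that(4) by simp
  have cluster: "\<exists>z. (\<forall>V. openin weak_topology V \<longrightarrow> z \<in> V \<longrightarrow> (\<exists>\<^sub>F n in sequentially. u (r (s n)) \<in> V))
      \<and> z \<in> closure D \<and> (\<forall>i. g i z = lim (\<lambda>k. g i (u (r k))))"
    if s: "strict_mono s" for s
  proof -
    obtain z where z: "\<And>V. openin weak_topology V \<Longrightarrow> z \<in> V \<Longrightarrow> \<exists>\<^sub>F n in sequentially. u (r (s n)) \<in> V"
      using compactin_cluster_point[OF K, of "\<lambda>n. u (r (s n))"] uK by metis
    \<comment> \<open>A functional separating \<open>z\<close> from the convex set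
      \<open>closure D\<close> would keep all \<open>h (u k)\<close> a fixed distance below
      \<open>h z\<close>, although \<open>z\<close> is a cluster point.\<close>
    have "z \<in> closure D"
    proof (rule ccontr)
      assume "z \<notin> closure D"
      moreover have "convex (closure D)" "closure D \<noteq> {}"
        using subspace_closure_rat_span[of u] \<open>D \<noteq> {}\<close> by (simp_all add: D_def subspace_imp_convex)
      ultimately obtain h :: "'a \<Rightarrow> real" and e
        where h: "bounded_linear h" "e > 0" "\<And>c. c \<in> closure D \<Longrightarrow> h c \<le> h z - e"
        using separating_functional[of "closure D" z] by auto
      have "\<exists>\<^sub>F n in sequentially. h (u (r (s n))) \<in> {h z - e<..}"
        using h by (intro frequent[OF z]) auto
      then obtain n where "h (u (r (s n))) > h z - e"
        by (auto dest: frequently_ex)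
      moreover have "u k \<in> closure D" for k
        using uD closure_subset by (rule subsetD[rotated])
      ultimately show False using h(3) by (metis not_less)
    qed
    moreover have "g i z = lim (\<lambda>k. g i (u (r k)))" for i
    proof (rule ccontr)
      let ?l = "lim (\<lambda>k. g i (u (r k)))"
      assume "g i z \<noteq> ?l"
      then obtain U V where UV: "open U" "open V" "g i z \<in> U" "?l \<in> V" "U \<inter> V = {}"
        using hausdorff by metis
      have "(\<lambda>k. g i (u (r k))) \<longlonglongrightarrow> ?l" using conv by (simp add: convergent_LIMSEQ_iff)
      from LIMSEQ_subseq_LIMSEQ[OF this s] have "\<forall>\<^sub>F n in sequentially. g i (u (r (s n))) \<in> V"
        using UV by (auto simp: o_def dest: topological_tendstoD)
      moreover have "\<exists>\<^sub>F n in sequentially. g i (u (r (s n))) \<in> U"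
        by (rule frequent[OF z g(1) UV(1,3)])
      ultimately obtain n where "g i (u (r (s n))) \<in> U" "g i (u (r (s n))) \<in> V"
        by (metis (mono_tags, lifting) frequently_ex frequently_eventually_frequently)
      then show False using UV(5) by blast
    qed
    ultimately show ?thesis using z by blast
  qed
  have unique: "z = z'" if "z \<in> closure D" "z' \<in> closure D" "\<And>i. g i z = g i z'" for z z'
  proof -
    have "norm (z - z') \<le> 0 + e" if "e > 0" for e
    proof -
      have "z - z' \<in> closure D"
        using subspace_closure_rat_span[of u] \<open>z \<in> closure D\<close> \<open>z' \<in> closure D\<close>
        unfolding D_def by (rule subspace_diff)
      then obtain i where i: "norm (d i - (z - z')) < e / 2"
        using d \<open>e > 0\<close> unfolding closure_approachable dist_norm by (metis half_gt_zero imageE)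
      \<comment> \<open>\<open>g i\<close> vanishes on \<open>z - z'\<close>, so the norm of
        \<open>d i\<close> is its value at a small vector.\<close>
      have "norm (d i) = g i (d i - (z - z'))"
        using g(2)[of i] \<open>\<And>i. g i z = g i z'\<close> by (simp add: linear_diff bounded_linear.linear[OF g(1)])
      also have "\<dots> \<le> norm (d i - (z - z'))"
        using g(3)[of i "d i - (z - z')"] by simp
      finally show ?thesis
        using i norm_triangle_ineq4[of "d i" "d i - (z - z')"] by simp
    qed
    then show ?thesis using field_le_epsilon[of "norm (z - z')" 0] by simp
  qed
  obtain z where z: "z \<in> closure D" "\<And>i. g i z = lim (\<lambda>k. g i (u (r k)))"
    using cluster[OF strict_mono_id] by auto
  have "(\<lambda>n. f (u (r n))) \<longlonglongrightarrow> f z" if f: "bounded_linear f" for f :: "'a \<Rightarrow> real"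
  proof (rule ccontr)
    assume "\<not> (\<lambda>n. f (u (r n))) \<longlonglongrightarrow> f z"
    then obtain e where e: "e > 0" "\<And>N. \<exists>n\<ge>N. \<not> dist (f (u (r n))) (f z) < e"
      unfolding lim_sequentially by metis
    \<comment> \<open>Enumerated, these indices form a subsequence whose cluster point must again be
      \<open>z\<close>, although \<open>f\<close> stays away from \<open>f z\<close> along
      it.\<close>
    define A where "A = {n. \<not> dist (f (u (r n))) (f z) < e}"
    have "infinite A"
      unfolding infinite_nat_iff_unbounded_le A_def using e(2) by auto
    then have s: "strict_mono (enumerate A)" "\<And>n. enumerate A n \<in> A"
      by (auto simp: strict_mono_enumerate enumerate_in_set)
    obtain y where y: "\<And>V. openin weak_topology V \<Longrightarrow> y \<in> V \<Longrightarrow>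
        \<exists>\<^sub>F n in sequentially. u (r (enumerate A n)) \<in> V"
      "y \<in> closure D" "\<And>i. g i y = lim (\<lambda>k. g i (u (r k)))"
      using cluster[OF s(1)] by auto
    have "y = z" using y(2,3) z by (intro unique) auto
    have "\<exists>\<^sub>F n in sequentially. f (u (r (enumerate A n))) \<in> ball (f z) e"
      using f e(1) by (intro frequent[OF y(1)]) (auto simp: \<open>y = z\<close>)
    then obtain n where "f (u (r (enumerate A n))) \<in> ball (f z) e"
      by (auto dest: frequently_ex)
    then show False using s(2)[of n] by (simp add: A_def dist_commute)
  qed
  then show thesis
    using that[OF r, of z] by (simp add: limitin_weak_topology_iff)
qed

section \<open>Banach lattices and positive operators\<close>

lemma norm_abs_lattice [simp]: "norm \<bar>x :: 'a::banach_lattice\<bar> = norm x"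
  by (rule antisym; rule norm_abs_mono) simp_all

lemma norm_mono_nonneg: "0 \<le> x \<Longrightarrow> x \<le> y \<Longrightarrow> norm x \<le> norm (y :: 'a::banach_lattice)"
  by (rule norm_abs_mono) (use order_trans in \<open>simp add: abs_of_nonneg\<close>)

lemma pprt_subadditive: "pprt (x + y) \<le> pprt x + pprt (y :: 'a::banach_lattice)"
  unfolding pprt_def by (simp add: le_supI add_mono)

lemma pprt_le_abs: "pprt x \<le> \<bar>x :: 'a::banach_lattice\<bar>"
  by (simp add: pprt_def abs_ge_self)

lemma le_pprt: "x \<le> pprt (x :: 'a::banach_lattice)"
  unfolding pprt_def by simp

lemma pprt_least: "x \<le> y \<Longrightarrow> 0 \<le> y \<Longrightarrow> pprt x \<le> (y :: 'a::banach_lattice)"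
  unfolding pprt_def by (rule le_supI)

lemma norm_pprt_le: "norm (pprt x) \<le> norm (x :: 'a::banach_lattice)"
  using norm_mono_nonneg[OF zero_le_pprt pprt_le_abs] by simp

lemma pprt_scaleR:
  fixes x :: "'a::banach_lattice"
  assumes "0 \<le> t"
  shows "pprt (t *\<^sub>R x) = t *\<^sub>R pprt x"
proof (cases "t = 0")
  case False
  with assms have t: "t > 0" by simp
  have le: "pprt (t *\<^sub>R x) \<le> t *\<^sub>R pprt x" if "t > 0" for t and x :: 'a
    using that by (intro pprt_least scaleR_left_mono scaleR_nonneg_nonneg le_pprt) simp_all
  have "t *\<^sub>R pprt x \<le> t *\<^sub>R ((1 / t) *\<^sub>R pprt (t *\<^sub>R x))"
    using le[of "1 / t" "t *\<^sub>R x"] t by (intro scaleR_left_mono) simp_all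
  then show ?thesis using le[OF t, of x] t by simp
qed simp

lemma abs_eq_pprt_add: "\<bar>x :: 'a::banach_lattice\<bar> = pprt x + pprt (- x)"
  by (simp add: abs_prts pprt_neg)

lemma abs_scaleR_lattice: "\<bar>t *\<^sub>R x\<bar> = \<bar>t\<bar> *\<^sub>R \<bar>x :: 'a::banach_lattice\<bar>"
proof (cases "0 \<le> t")
  case True
  then show ?thesis
    using pprt_scaleR[OF True, of x] pprt_scaleR[OF True, of "- x"]
    by (simp add: abs_eq_pprt_add scaleR_add_right)
next
  case False
  then have "0 \<le> - t" by simp
  from pprt_scaleR[OF this, of x] pprt_scaleR[OF this, of "- x"] False show ?thesis
    by (simp add: abs_eq_pprt_add algebra_simps)
qed

text \<open>From \<open>0 \<le> X n\<close> it follows that \<open>- x \<le> X n - x\<close>, so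
  \<open>pprt (- x)\<close> is dominated by \<open>\<bar>X n - x\<bar>\<close>, whose norm tends to
  0.\<close>

lemma nonneg_LIMSEQ:
  fixes x :: "'a::banach_lattice"
  assumes "X \<longlonglongrightarrow> x" and "\<And>n. 0 \<le> X n"
  shows "0 \<le> x"
proof -
  have "norm (pprt (- x)) \<le> norm (X n - x)" for n
  proof -
    have "pprt (- x) \<le> \<bar>X n - x\<bar>"
      using assms(2)[of n] abs_ge_self[of "X n - x"] by (intro pprt_least) (auto intro: order_trans[rotated])
    then show ?thesis using norm_mono_nonneg[OF zero_le_pprt] by fastforce
  qed
  moreover have "(\<lambda>n. norm (X n - x)) \<longlonglongrightarrow> 0"
    using assms(1) by (simp add: LIM_zero tendsto_norm_zero)
  ultimately have "norm (pprt (- x)) \<le> 0"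
    by (intro LIMSEQ_le_const) auto
  then have "pprt (- x) = 0" by simp
  then show ?thesis using le_pprt[of "- x"] by simp
qed

lemma LIMSEQ_mono:
  fixes x y :: "'a::banach_lattice"
  assumes "X \<longlonglongrightarrow> x" "Y \<longlonglongrightarrow> y" and "\<And>n. X n \<le> Y n"
  shows "x \<le> y"
  using nonneg_LIMSEQ[OF tendsto_diff[OF assms(2,1)]] assms(3) by simp

lemma banach_lattice_archimedean:
  fixes x y :: "'a::banach_lattice"
  assumes "\<And>n. real n *\<^sub>R x \<le> y"
  shows "x \<le> 0"
proof -
  have "real n * norm (pprt x) \<le> norm (pprt y)" for n
  proof -
    have "real n *\<^sub>R pprt x \<le> pprt y"
      using pprt_mono[OF assms[of n]] by (simp add: pprt_scaleR)
    then show ?thesis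
      using norm_mono_nonneg[of "real n *\<^sub>R pprt x" "pprt y"] by (simp add: scaleR_nonneg_nonneg)
  qed
  then have "norm (pprt x) = 0"
    by (metis norm_ge_zero order_less_le reals_Archimedean3 not_le)
  then have "pprt x = 0" by simp
  then show ?thesis using le_pprt[of x] by simp
qed

text \<open>The subgradient is taken of the sublinear function \<open>norm (pprt y)\<close>. This
  vanishes for \<open>y \<le> 0\<close>, which makes \<open>g\<close> positive, and agrees with the
  norm at \<open>x\<close>.\<close>

lemma positive_norming_functional:
  fixes x :: "'a::banach_lattice"
  assumes "0 \<le> x"
  obtains g :: "'a \<Rightarrow> real"
  where "bounded_linear g" "g x = norm x" "\<And>y. 0 \<le> y \<Longrightarrow> 0 \<le> g y" "\<And>y. \<bar>g y\<bar> \<le> norm y"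
proof -
  let ?J = "\<lambda>y :: 'a. norm (pprt y)"
  have sub: "?J (a + b) \<le> ?J a + ?J b" for a b
    using norm_mono_nonneg[OF zero_le_pprt pprt_subadditive] norm_triangle_ineq order_trans by blast
  have "convex_on UNIV ?J"
  proof (rule convex_onI)
    fix t :: real and a b :: 'a assume "0 < t" "t < 1"
    then show "?J ((1 - t) *\<^sub>R a + t *\<^sub>R b) \<le> (1 - t) * ?J a + t * ?J b"
      using sub[of "(1 - t) *\<^sub>R a" "t *\<^sub>R b"] by (simp add: pprt_scaleR)
  qed simp
  moreover have "?J (a + b) \<le> ?J a + 1 * norm b" for a b
    using sub[of a b] norm_pprt_le[of b] by simp
  ultimately obtain g where g: "bounded_linear g" "\<And>y. g y \<le> ?J (x + y) - ?J x"
    by (rule convex_subgradient) blast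
  interpret bounded_linear g by fact
  have le: "g y \<le> ?J y" for y
    using g(2)[of y] sub[of x y] by simp
  have pos: "0 \<le> g y" if "0 \<le> y" for y
    using le[of "- y"] that by (simp add: neg)
  have "\<bar>g y\<bar> \<le> norm y" for y
    using le[of y] le[of "- y"] norm_pprt_le[of y] norm_pprt_le[of "- y"] by (simp add: neg abs_le_iff)
  moreover have "g x = norm x"
    using le[of x] g(2)[of "- x"] assms by (simp add: neg)
  ultimately show thesis using that g(1) pos by blast
qed

section \<open>Positive operators and their automatic continuity\<close>

lemma positive_mono:
  fixes S :: "'a::banach_lattice \<Rightarrow> 'b::banach_lattice"
  assumes "linear S" "\<And>x. 0 \<le> x \<Longrightarrow> 0 \<le> S x" "x \<le> y"
  shows "S x \<le> S y"
  using assms(2)[of "y - x"] assms(3) linear_diff[OF assms(1), of y x] by simp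

lemma positive_abs_le:
  fixes S :: "'a::banach_lattice \<Rightarrow> 'b::banach_lattice"
  assumes "linear S" "\<And>x. 0 \<le> x \<Longrightarrow> 0 \<le> S x"
  shows "\<bar>S x\<bar> \<le> S \<bar>x\<bar>"
proof (rule abs_leI)
  show "S x \<le> S \<bar>x\<bar>"
    using assms by (rule positive_mono) (simp_all add: abs_ge_self)
  have "S (- x) \<le> S \<bar>x\<bar>"
    using assms by (rule positive_mono) (simp_all add: abs_ge_minus_self)
  then show "- S x \<le> S \<bar>x\<bar>"
    using linear_neg[OF assms(1), of x] by simp
qed

text \<open>Otherwise there are positive \<open>y n\<close> of norm \<open>(1 / 2) ^ n\<close> with
  \<open>norm (S (y n)) > n\<close>. The sum of the series dominates every \<open>y n\<close>, so
  positivity bounds all these norms by a single number.\<close>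

theorem positive_imp_bounded_linear:
  fixes S :: "'a::banach_lattice \<Rightarrow> 'b::banach_lattice"
  assumes S: "linear S" "\<And>x. 0 \<le> x \<Longrightarrow> 0 \<le> S x"
  shows "bounded_linear S"
proof -
  have "\<exists>K. \<forall>x\<ge>0. norm (S x) \<le> K * norm x"
  proof (rule ccontr)
    assume "\<nexists>K. \<forall>x\<ge>0. norm (S x) \<le> K * norm x"
    then have "\<forall>n :: nat. \<exists>x\<ge>0. norm (S x) > (real n * 2 ^ n) * norm x"
      by (simp add: not_le)
    then obtain x where x: "\<And>n. 0 \<le> x n" "\<And>n. norm (S (x n)) > (real n * 2 ^ n) * norm (x n)"
      by metis
    define y where "y n = (1 / (2 ^ n * norm (x n))) *\<^sub>R x n" for n
    have nz: "norm (x n) > 0" for n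
      using x(2)[of n] linear_0[OF S(1)] by (cases "x n = 0") auto
    have y0: "0 \<le> y n" for n
      unfolding y_def using x(1)[of n] by (intro scaleR_nonneg_nonneg) simp_all
    have ny: "norm (y n) = (1 / 2) ^ n" for n
      using nz[of n] by (simp add: y_def power_one_over)
    have nS: "norm (S (y n)) > real n" for n
      using x(2)[of n] nz[of n] by (simp add: y_def linear_scale[OF S(1)] field_simps)
    have "summable y"
      by (rule summable_norm_cancel) (simp add: ny summable_geometric)
    then have lim: "(\<lambda>m. \<Sum>k<m. y k) \<longlonglongrightarrow> suminf y" by (rule summable_LIMSEQ)
    have "y n \<le> suminf y" for n
    proof (rule LIMSEQ_mono[OF tendsto_const])
      \<comment> \<open>After the shift by \<open>Suc n\<close> every partial sum contains the term
        \<open>y n\<close>.\<close>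
      show "(\<lambda>m. \<Sum>k<m + Suc n. y k) \<longlonglongrightarrow> suminf y" using lim by (rule LIMSEQ_ignore_initial_segment)
      show "y n \<le> (\<Sum>k<m + Suc n. y k)" for m
        using sum_mono2[of "{..<m + Suc n}" "{n}" y] by (simp add: y0)
    qed
    then have "norm (S (y n)) \<le> norm (S (suminf y))" for n
      using positive_mono[OF S] S(2)[OF y0] by (intro norm_mono_nonneg) auto
    then have "real n < norm (S (suminf y))" for n
      using nS[of n] by (meson order_less_le_trans)
    then show False using reals_Archimedean2 by (meson not_less_iff_gr_or_eq)
  qed
  then obtain K where K: "\<And>x. 0 \<le> x \<Longrightarrow> norm (S x) \<le> K * norm x" by blast
  have "norm (S x) \<le> norm x * K" for x
  proof -
    have "norm (S x) \<le> norm (S \<bar>x\<bar>)"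
      using norm_abs_mono[of "S x" "S \<bar>x\<bar>"] positive_abs_le[OF S] S(2)[of "\<bar>x\<bar>"] by simp
    then show ?thesis using K[of "\<bar>x\<bar>"] by (simp add: mult.commute)
  qed
  then show ?thesis
    using S(1) by (intro bounded_linear_intro[of S K]) (simp_all add: linear_add linear_scale)
qed

text \<open>No supremum is given beforehand, so the net consists of all differences
  \<open>u - a n\<close> with \<open>u\<close> an upper bound. Once one of them has small norm, so
  has \<open>a m - a n \<le> u - a n\<close> for \<open>m \<ge> n\<close>, and the sequence is
  Cauchy.\<close>

lemma order_continuous_incseq_convergent:
  fixes a :: "nat \<Rightarrow> 'a::banach_lattice"
  assumes oc: "order_continuous TYPE('a)"
    and inc: "\<And>n. a n \<le> a (Suc n)" and bd: "\<And>n. a n \<le> c"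
  shows "convergent a"
proof -
  define U where "U = {u. \<forall>n. a n \<le> u}"
  define I where "I = U \<times> (UNIV :: nat set)"
  define le :: "'a \<times> nat \<Rightarrow> 'a \<times> nat \<Rightarrow> bool" where "le p q \<longleftrightarrow> fst q \<le> fst p \<and> snd p \<le> snd q" for p q
  define x where "x p = fst p - a (snd p)" for p :: "'a \<times> nat"
  have mono: "a m \<le> a n" if "m \<le> n" for m n
    using lift_Suc_mono_le[of a, OF inc that] .
  have cU: "c \<in> U" using bd by (simp add: U_def)
  have "directed_preorder I le"
    unfolding directed_preorder_def
  proof (intro conjI ballI impI)
    show "I \<noteq> {}" using cU by (auto simp: I_def)
    fix p q assume "p \<in> I" "q \<in> I"
    then show "\<exists>k\<in>I. le p k \<and> le q k"
      by (intro bexI[of _ "(inf (fst p) (fst q), max (snd p) (snd q))"])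
        (auto simp: I_def U_def le_def)
  qed (auto simp: le_def)
  moreover have "net_decreases_to_zero I le x"
    unfolding net_decreases_to_zero_def
  proof (intro conjI ballI impI allI)
    fix p q assume "p \<in> I" "q \<in> I" "le p q"
    then show "x q \<le> x p" using mono by (auto simp: x_def le_def intro: diff_mono)
  next
    fix p assume "p \<in> I"
    then show "0 \<le> x p" by (auto simp: x_def I_def U_def)
  next
    fix z assume z: "\<forall>p\<in>I. z \<le> x p"
    \<comment> \<open>A lower bound \<open>z\<close> of the net can be subtracted from upper bounds
      arbitrarily often; the Archimedean property then gives \<open>z \<le> 0\<close>.\<close>
    have step: "u - z \<in> U" if "u \<in> U" for u
      unfolding U_def
    proof (intro CollectI allI)
      fix n
      have "z \<le> u - a n" using z[rule_format, of "(u, n)"] that by (simp add: I_def x_def)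
      then show "a n \<le> u - z" by (simp add: algebra_simps)
    qed
    have "c - real k *\<^sub>R z \<in> U" for k
    proof (induction k)
      case (Suc k)
      from step[OF this] show ?case by (simp add: algebra_simps)
    qed (use cU in simp)
    then have "a 0 \<le> c - real k *\<^sub>R z" for k by (simp add: U_def)
    then have "real k *\<^sub>R z \<le> c - a 0" for k by (simp add: algebra_simps)
    then show "z \<le> 0" by (rule banach_lattice_archimedean)
  qed
  ultimately have N: "net_norm_null I le x" by (rule order_continuousD[OF oc])
  have "Cauchy a"
  proof (rule CauchyI)
    fix e :: real assume "e > 0"
    then have "e / 2 > 0" by simp
    with N obtain p where p: "p \<in> I" "\<And>q. q \<in> I \<Longrightarrow> le p q \<Longrightarrow> norm (x q) < e / 2"
      unfolding net_norm_null_def by metis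
    define u n where "u = fst p" and "n = snd p"
    have "norm (u - a n) < e / 2"
      using p(2)[OF p(1)] by (simp add: x_def le_def u_def n_def)
    moreover have "norm (a m - a n) \<le> norm (u - a n)" if "m \<ge> n" for m
      using p(1) mono[OF that] by (intro norm_mono_nonneg) (auto simp: I_def U_def u_def intro: diff_right_mono)
    ultimately have near: "norm (a m - a n) < e / 2" if "m \<ge> n" for m
      using that by (meson order_le_less_trans)
    have "norm (a m - a k) < e" if "m \<ge> n" "k \<ge> n" for m k
      using norm_triangle_ineq4[of "a m - a n" "a k - a n"] near[OF that(1)] near[OF that(2)] by simp
    then show "\<exists>M. \<forall>m\<ge>M. \<forall>k\<ge>M. norm (a m - a k) < e" by blast
  qed
  then show ?thesis by (simp add: Cauchy_convergent)
qed

section \<open>Functionals controlling an order interval\<close>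

text \<open>
  If no functional works for \<open>e\<close>, one builds \<open>w\<^sub>j \<in> [0, c]\<close> with norming functionals \<open>g\<^sub>j\<close> such that
  \<open>g\<^sub>j w\<^sub>j \<ge> e\<close> while \<open>g\<^sub>i w\<^sub>j\<close> is tiny for \<open>i < j\<close>. Then the decreasing sequence
  \<open>z\<^sub>i = sup\<^bsub>j \<ge> i\<^esub> w\<^sub>j\<close> satisfies \<open>g\<^sub>i (z\<^sub>i - z\<^sub>i\<^sub>+\<^sub>1) \<ge> e / 2\<close> and cannot converge.
\<close>

lemma order_interval_small:
  fixes c :: "'a::banach_lattice"
  assumes oc: "order_continuous TYPE('a)" and e: "e > 0"
  obtains f :: "'a \<Rightarrow> real" and d where "bounded_linear f" "\<And>x. 0 \<le> x \<Longrightarrow> 0 \<le> f x" "d > 0"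
    "\<And>w. 0 \<le> w \<Longrightarrow> w \<le> c \<Longrightarrow> f w < d \<Longrightarrow> norm w < e"
proof (rule ccontr)
  assume "\<not> thesis"
  note nothesis = this and thesis = that
  \<comment> \<open>A choice function of \<open>f\<close> and \<open>d\<close> lets the
    counterexamples be selected by plain recursion.\<close>
  define W where "W f d = (SOME w. 0 \<le> w \<and> w \<le> c \<and> f w < d \<and> e \<le> norm w)"
    for f :: "'a \<Rightarrow> real" and d
  have W: "0 \<le> W f d \<and> W f d \<le> c \<and> f (W f d) < d \<and> e \<le> norm (W f d)"
    if "bounded_linear f" "\<And>x. 0 \<le> x \<Longrightarrow> 0 \<le> f x" "d > 0" for f d
  proof -
    have "\<exists>w. 0 \<le> w \<and> w \<le> c \<and> f w < d \<and> e \<le> norm w"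
    proof (rule ccontr)
      assume "\<nexists>w. 0 \<le> w \<and> w \<le> c \<and> f w < d \<and> e \<le> norm w"
      then have thesis by (intro thesis[OF that]) force+
      with nothesis show False by blast
    qed
    then show ?thesis unfolding W_def by (rule someI_ex)
  qed
  have "\<exists>g :: 'a \<Rightarrow> real. 0 \<le> x \<longrightarrow> bounded_linear g \<and> g x = norm x \<and> (\<forall>y\<ge>0. 0 \<le> g y) \<and>
      (\<forall>y. \<bar>g y\<bar> \<le> norm y)" for x :: 'a
  proof (cases "0 \<le> x")
    case True
    then obtain g :: "'a \<Rightarrow> real" where "bounded_linear g" "g x = norm x"
      "\<And>y. 0 \<le> y \<Longrightarrow> 0 \<le> g y" "\<And>y. \<bar>g y\<bar> \<le> norm y"
      by (rule positive_norming_functional) blast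
    then show ?thesis by blast
  qed simp
  then obtain N :: "'a \<Rightarrow> 'a \<Rightarrow> real" where N: "\<And>x. 0 \<le> x \<Longrightarrow> bounded_linear (N x)"
    "\<And>x. 0 \<le> x \<Longrightarrow> N x x = norm x" "\<And>x y. 0 \<le> x \<Longrightarrow> 0 \<le> y \<Longrightarrow> 0 \<le> N x y"
    "\<And>x y. 0 \<le> x \<Longrightarrow> \<bar>N x y\<bar> \<le> norm y"
    by metis
  \<comment> \<open>Chosen so that the \<open>d j\<close> with \<open>j > i\<close> sum to less than
    \<open>e / 2\<close>.\<close>
  define d where "d j = e / 2 ^ (j + 2)" for j :: nat
  have d: "d j > 0" for j using e by (simp add: d_def)
  \<comment> \<open>\<open>F j\<close> is the sum of the norming functionals of
    \<open>w 0, ..., w (j - 1)\<close>; all of them being positive, \<open>F j (w j) < d j\<close>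
    makes each one small at \<open>w j\<close>.\<close>
  define F where "F = rec_nat (\<lambda>_. 0) (\<lambda>j f x. f x + N (W f (d j)) x)"
  define w where "w j = W (F j) (d j)" for j
  have F_Suc: "F (Suc j) = (\<lambda>x. F j x + N (w j) x)" for j
    by (simp add: F_def w_def)
  have F: "bounded_linear (F j) \<and> (\<forall>x\<ge>0. 0 \<le> F j x)" for j
  proof (induction j)
    case 0
    show ?case by (simp add: F_def)
  next
    case (Suc j)
    then have "0 \<le> w j" using W[of "F j" "d j"] d by (simp add: w_def)
    with Suc N show ?case by (simp add: F_Suc bounded_linear_add)
  qed
  have w: "0 \<le> w j" "w j \<le> c" "F j (w j) < d j" "e \<le> norm (w j)" for j
    using W[of "F j" "d j"] F[of j] d by (simp_all add: w_def)
  have F_ge: "N (w i) x \<le> F j x" if "i < j" "0 \<le> x" for i j x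
    using that(1)
  proof (induction j)
    case (Suc j)
    then show ?case
      using N(3)[OF w(1) that(2)] F \<open>0 \<le> x\<close> by (cases "i = j") (auto simp: F_Suc less_Suc_eq intro: add_increasing2)
  qed simp
  have small: "N (w i) (w j) < d j" if "i < j" for i j
    using F_ge[OF that w(1)[of j]] w(3)[of j] by simp
  \<comment> \<open>\<open>s i n\<close> is the supremum of
    \<open>w i, ..., w (i + n)\<close>.\<close>
  define s where "s i = rec_nat (w i) (\<lambda>n y. sup y (w (i + Suc n)))" for i
  have s_0: "s i 0 = w i" and s_Suc: "s i (Suc n) = sup (s i n) (w (i + Suc n))" for i n
    by (simp_all add: s_def)
  have s_ge: "0 \<le> s i n" for i n
    by (induction n) (auto simp: s_0 s_Suc w(1) intro: le_supI1)
  have s_le: "s i n \<le> c" for i n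
    by (induction n) (simp_all add: s_0 s_Suc w(2))
  have w_le: "w i \<le> s i n" for i n
    by (induction n) (auto simp: s_0 s_Suc intro: le_supI1)
  have s_shift: "s (Suc i) n \<le> s i (Suc n)" for i n
    by (induction n) (auto simp: s_0 s_Suc intro: le_supI1)
  have "convergent (s i)" for i
    using order_continuous_incseq_convergent[OF oc, of "s i" c] by (simp add: s_Suc s_le)
  then obtain z where z: "\<And>i. s i \<longlonglongrightarrow> z i"
    unfolding convergent_def by metis
  have z_ge: "0 \<le> z i" for i using nonneg_LIMSEQ[OF z s_ge] .
  have z_dec: "z (Suc i) \<le> z i" for i
    by (rule LIMSEQ_mono[OF z LIMSEQ_Suc[OF z] s_shift])
  have gap: "e / 2 \<le> norm (z i - z (Suc i))" for i
  proof -
    interpret bounded_linear "N (w i)" using N(1) w(1) .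
    have mono: "N (w i) x \<le> N (w i) y" if "x \<le> y" for x y
      using N(3)[OF w(1), of "y - x" i] that by (simp add: diff)
    \<comment> \<open>A supremum of positive elements is below their sum, so the bounds
      \<open>d (i + 1), d (i + 2), ...\<close> add up.\<close>
    have "N (w i) (s (Suc i) n) \<le> e / 2 * (1 - 1 / 2 ^ Suc n)" for n
    proof (induction n)
      case 0
      have "d (Suc i) \<le> e / 2 ^ 2"
        unfolding d_def using e by (intro divide_left_mono power_increasing) auto
      then show ?case using small[of i "Suc i"] by (simp add: s_0)
    next
      case (Suc n)
      have "s (Suc i) (Suc n) \<le> s (Suc i) n + w (Suc i + Suc n)"
        using s_ge w(1) by (simp add: s_Suc add_increasing add_increasing2)
      then have "N (w i) (s (Suc i) (Suc n)) \<le> N (w i) (s (Suc i) n) + N (w i) (w (Suc i + Suc n))"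
        using mono add by metis
      also have "\<dots> \<le> e / 2 * (1 - 1 / 2 ^ Suc n) + d (Suc i + Suc n)"
        by (rule add_mono[OF Suc less_imp_le[OF small]]) simp
      also have "d (Suc i + Suc n) \<le> e / 2 ^ (n + 3)"
        unfolding d_def using e by (intro divide_left_mono power_increasing) auto
      also have "e / 2 * (1 - 1 / 2 ^ Suc n) + e / 2 ^ (n + 3) = e / 2 * (1 - 1 / 2 ^ Suc (Suc n))"
        by (simp add: field_simps power_add)
      finally show ?case by simp
    qed
    moreover have "e / 2 * (1 - 1 / 2 ^ Suc n) \<le> e / 2" for n
      using e by (simp add: field_simps)
    ultimately have "N (w i) (s (Suc i) n) \<le> e / 2" for n
      by (rule order_trans)
    then have "N (w i) (z (Suc i)) \<le> e / 2"
      using LIMSEQ_le_const2[OF tendsto[OF z]] by blast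
    moreover have "w i \<le> z i"
      using LIMSEQ_mono[OF tendsto_const z w_le] .
    then have "e \<le> N (w i) (z i)"
      using mono[of "w i" "z i"] N(2)[OF w(1)] w(4)[of i] by simp
    ultimately have "e / 2 \<le> N (w i) (z i - z (Suc i))" by (simp add: diff)
    then show ?thesis using N(4)[OF w(1), of i "z i - z (Suc i)"] by simp
  qed
  have "convergent (\<lambda>i. - z i)"
    using oc by (rule order_continuous_incseq_convergent[where c = 0]) (simp_all add: z_dec z_ge)
  then obtain l where l: "z \<longlonglongrightarrow> l"
    unfolding convergent_minus_iff[symmetric, of z] convergent_def by blast
  have "(\<lambda>i. norm (z i - z (Suc i))) \<longlonglongrightarrow> norm (l - l)"
    by (intro tendsto_intros l LIMSEQ_Suc)
  then have "e / 2 \<le> norm (l - l)"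
    using gap by (intro LIMSEQ_le_const) auto
  then show False using e by simp
qed

text \<open>Functionals for the tolerances \<open>1 / (m + 1)\<close> are combined into one weighted
  sum; by positivity, smallness of the sum forces smallness of every summand.\<close>

theorem order_continuous_dominating_functional:
  fixes c :: "'a::banach_lattice"
  assumes oc: "order_continuous TYPE('a)"
  obtains f :: "'a \<Rightarrow> real" where "bounded_linear f" "\<And>x. 0 \<le> x \<Longrightarrow> 0 \<le> f x"
    "\<And>w. (\<And>n. 0 \<le> w n) \<Longrightarrow> (\<And>n. w n \<le> c) \<Longrightarrow> (\<lambda>n. f (w n)) \<longlonglongrightarrow> 0 \<Longrightarrow> w \<longlonglongrightarrow> 0"
proof -
  have "\<exists>(f :: 'a \<Rightarrow> real) d. bounded_linear f \<and> (\<forall>x\<ge>0. 0 \<le> f x) \<and> d > 0 \<and>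
      (\<forall>w. 0 \<le> w \<longrightarrow> w \<le> c \<longrightarrow> f w < d \<longrightarrow> norm w < 1 / real (Suc m))" for m
    by (rule order_interval_small[OF oc, of "1 / real (Suc m)" c]) (simp, blast)
  then obtain f :: "nat \<Rightarrow> 'a \<Rightarrow> real" and d where f: "\<And>m. bounded_linear (f m)"
    "\<And>m x. 0 \<le> x \<Longrightarrow> 0 \<le> f m x" and d: "\<And>m. d m > 0"
    "\<And>m w. 0 \<le> w \<Longrightarrow> w \<le> c \<Longrightarrow> f m w < d m \<Longrightarrow> norm w < 1 / real (Suc m)"
    by metis
  have "\<exists>B>0. \<forall>x. norm (f m x) \<le> norm x * B" for m
    using bounded_linear.pos_bounded[OF f(1)] .
  then obtain B where B: "\<And>m. B m > 0" "\<And>m x. norm (f m x) \<le> norm x * B m" by metis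
  \<comment> \<open>Dividing by the norm bound \<open>B m\<close> and weighting geometrically makes
    the series absolutely convergent.\<close>
  define h where "h m x = f m x / B m * (1 / 2) ^ m" for m x
  have h: "norm (h m x) \<le> norm x * (1 / 2) ^ m" for m x
    unfolding h_def norm_mult norm_power using B(1)[of m] B(2)[of m x]
    by (intro mult_mono) (simp_all add: norm_divide field_simps)
  have sum_geo: "summable (\<lambda>m. norm x * (1 / 2) ^ m :: real)" for x :: 'a
    by (intro summable_mult summable_geometric) simp
  have sum_norm: "summable (\<lambda>m. norm (h m x))" for x
    by (rule summable_comparison_test[OF _ sum_geo[of x]]) (use h in auto)
  have sums: "summable (\<lambda>m. h m x)" for x
    by (rule summable_norm_cancel[OF sum_norm])
  define g where "g x = (\<Sum>m. h m x)" for x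
  have "bounded_linear g"
  proof (rule bounded_linear_intro[of g 2])
    have add: "h m (x + y) = h m x + h m y" for m x y
      by (simp add: h_def linear_add[OF bounded_linear.linear[OF f(1)]] add_divide_distrib distrib_right)
    show "g (x + y) = g x + g y" for x y
      unfolding g_def using suminf_add[OF sums sums] by (simp add: add)
    have scale: "h m (r *\<^sub>R x) = r * h m x" for m r x
      by (simp add: h_def linear_scale[OF bounded_linear.linear[OF f(1)]])
    show "g (r *\<^sub>R x) = r *\<^sub>R g x" for r x
      unfolding g_def using suminf_mult[OF sums, of r x] by (simp add: scale)
    show "norm (g x) \<le> norm x * 2" for x
    proof -
      have "norm (g x) \<le> (\<Sum>m. norm (h m x))"
        unfolding g_def by (rule summable_norm[OF sum_norm])
      also have "\<dots> \<le> (\<Sum>m. norm x * (1 / 2) ^ m)"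
        by (rule suminf_le[OF h sum_norm sum_geo])
      also have "\<dots> = norm x * 2"
        by (subst suminf_mult) (simp_all add: suminf_geometric summable_geometric)
      finally show ?thesis .
    qed
  qed
  moreover have h_pos: "0 \<le> h m x" if "0 \<le> x" for m x
    using f(2)[OF that] B(1)[of m] by (simp add: h_def)
  have h_le: "h m x \<le> g x" if "0 \<le> x" for m x
    unfolding g_def using sum_le_suminf[OF sums, of "{m}" x] h_pos[OF that] by simp
  have "0 \<le> g x" if "0 \<le> x" for x
    using h_le[OF that, of 0] h_pos[OF that, of 0] by simp
  moreover have "w \<longlonglongrightarrow> 0" if w: "\<And>n. 0 \<le> w n" "\<And>n. w n \<le> c" "(\<lambda>n. g (w n)) \<longlonglongrightarrow> 0" for w
  proof (rule metric_LIMSEQ_I)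
    fix r :: real assume "r > 0"
    then obtain m where m: "1 / real (Suc m) < r" using nat_approx_posE by blast
    have "d m / B m * (1 / 2) ^ m > 0" using d(1) B(1) by simp
    then have "\<forall>\<^sub>F n in sequentially. g (w n) < d m / B m * (1 / 2) ^ m"
      using w(3) by (rule order_tendstoD(2)[rotated])
    then obtain M where M: "\<And>n. n \<ge> M \<Longrightarrow> g (w n) < d m / B m * (1 / 2) ^ m"
      unfolding eventually_sequentially by blast
    have "dist (w n) 0 < r" if "n \<ge> M" for n
    proof -
      have "h m (w n) < d m / B m * (1 / 2) ^ m"
        using h_le[OF w(1)] M[OF that] by (meson order_le_less_trans)
      then have "f m (w n) < d m"
        using B(1)[of m] by (simp add: h_def divide_less_cancel)
      then show ?thesis using d(2)[OF w(1,2)] m by (fastforce simp: dist_norm)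
    qed
    then show "\<exists>M. \<forall>n\<ge>M. dist (w n) 0 < r" by blast
  qed
  ultimately show thesis by (rule that)
qed

section \<open>Weak limits of positive sequences\<close>

lemma inf_eq_diff_pprt: "inf a z = a - pprt (a - z)" for a z :: "'a::banach_lattice"
proof -
  have "sup a z = pprt (a - z) + z" by (simp add: pprt_def add_sup_distrib_right)
  then show ?thesis using add_eq_inf_sup[of a z] by (simp add: algebra_simps)
qed

lemma pprt_pprt_diff:
  fixes b z :: "'a::banach_lattice"
  assumes "0 \<le> z"
  shows "pprt (pprt b - z) = pprt (b - z)"
proof (rule antisym)
  have "pprt b \<le> pprt (b - z) + z"
    using le_pprt[of "b - z"] assms by (intro pprt_least) (simp_all add: algebra_simps)
  then show "pprt (pprt b - z) \<le> pprt (b - z)"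
    by (intro pprt_least) (simp_all add: algebra_simps)
  show "pprt (b - z) \<le> pprt (pprt b - z)"
    by (intro pprt_mono diff_right_mono le_pprt)
qed

text \<open>Cuts \<open>v\<close> into layers \<open>?p i - ?p (Suc i)\<close>, each equal to
  \<open>inf (?p i) z\<close> and hence above \<open>inf (?p K) z\<close>; the \<open>K\<close>
  layers telescope to at most \<open>v\<close>. So the part of \<open>v\<close> exceeding
  \<open>K z\<close> is almost disjoint from \<open>z\<close> for large \<open>K\<close>.\<close>

lemma scaleR_inf_pprt_le:
  fixes v z :: "'a::banach_lattice"
  assumes v: "0 \<le> v" and z: "0 \<le> z"
  shows "real K *\<^sub>R inf (pprt (v - real K *\<^sub>R z)) z \<le> v"
proof -
  let ?p = "\<lambda>i. pprt (v - real i *\<^sub>R z)"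
  have "inf (?p K) z \<le> ?p i - ?p (Suc i)" if "i < K" for i
  proof -
    have "?p K \<le> ?p i"
      using that z by (intro pprt_mono diff_left_mono scaleR_right_mono) simp_all
    then have "inf (?p K) z \<le> inf (?p i) z" by (rule inf_mono) simp
    also have "\<dots> = ?p i - ?p (Suc i)"
      by (simp add: inf_eq_diff_pprt pprt_pprt_diff[OF z] algebra_simps)
    finally show ?thesis .
  qed
  then have "(\<Sum>i<K. inf (?p K) z) \<le> (\<Sum>i<K. ?p i - ?p (Suc i))"
    by (intro sum_mono) simp
  also have "\<dots> = v - ?p K"
    using sum_lessThan_telescope'[of ?p K] v by simp
  also have "\<dots> \<le> v" by simp
  finally show ?thesis by (simp add: sum_constant_scaleR)
qed

text \<open>The right side is the infimum of \<open>a + b\<close>, \<open>a + z\<close>,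
  \<open>z + b\<close> and \<open>z + z\<close>.\<close>

lemma inf_add_le:
  fixes a b z :: "'a::banach_lattice"
  assumes "0 \<le> a" "0 \<le> b" "0 \<le> z"
  shows "inf (a + b) z \<le> inf a z + inf b z"
proof -
  have "inf (a + b) z \<le> a + z" "inf (a + b) z \<le> z + b" "inf (a + b) z \<le> z + z"
    using assms by (auto intro: le_infI2 simp: add_increasing add_increasing2)
  then show ?thesis by (simp add: add_inf_distrib_left add_inf_distrib_right)
qed

lemma inf_sum_le:
  fixes f :: "'i \<Rightarrow> 'a::banach_lattice"
  assumes "finite A" "\<And>i. i \<in> A \<Longrightarrow> 0 \<le> f i" "0 \<le> z"
  shows "inf (sum f A) z \<le> (\<Sum>i\<in>A. inf (f i) z)"
  using assms(1,2)
proof (induction A rule: finite_induct)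
  case (insert i A)
  have "inf (f i + sum f A) z \<le> inf (f i) z + inf (sum f A) z"
    using insert.prems assms(3) by (intro inf_add_le sum_nonneg) simp_all
  also have "\<dots> \<le> inf (f i) z + (\<Sum>i\<in>A. inf (f i) z)"
    using insert.prems by (intro add_left_mono insert.IH) simp
  finally show ?case using insert.hyps by simp
qed (simp add: assms(3) inf_absorb1)

text \<open>Mazur's theorem: a functional separating \<open>z\<close> from the hull would contradict
  weak convergence.\<close>

lemma weak_limit_in_closure_convex_hull:
  fixes v :: "nat \<Rightarrow> 'a::real_normed_vector"
  assumes "limitin weak_topology v z sequentially"
  shows "z \<in> closure (convex hull (range v))"
proof (rule ccontr)
  assume "z \<notin> closure (convex hull (range v))"
  then obtain g :: "'a \<Rightarrow> real" and d where g: "bounded_linear g" "d > 0"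
    "\<And>c. c \<in> convex hull (range v) \<Longrightarrow> g c \<le> g z - d"
    using separating_functional[of "convex hull (range v)" z] by auto
  have "(\<lambda>n. g (v n)) \<longlonglongrightarrow> g z"
    using assms g(1) by (simp add: limitin_weak_topology_iff)
  moreover have "g (v n) \<le> g z - d" for n
    by (intro g(3) hull_inc) simp
  ultimately have "g z \<le> g z - d"
    by (intro LIMSEQ_le_const2) auto
  then show False using g(2) by simp
qed

lemma weak_limit_nonneg:
  fixes v :: "nat \<Rightarrow> 'a::banach_lattice"
  assumes lim: "limitin weak_topology v z sequentially" and v: "\<And>n. 0 \<le> v n"
  shows "0 \<le> z"
proof -
  have "convex {0 :: 'a ..}"
    by (auto simp: convex_def scaleR_nonneg_nonneg)
  moreover have "closed {0 :: 'a ..}"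
    unfolding closed_sequential_limits using nonneg_LIMSEQ by auto
  ultimately have "closure (convex hull (range v)) \<subseteq> {0..}"
    using v by (intro closure_minimal hull_minimal) auto
  then show ?thesis using weak_limit_in_closure_convex_hull[OF lim] by auto
qed

locale positive_functional = bounded_linear \<theta> for \<theta> :: "'a::banach_lattice \<Rightarrow> real" +
  assumes nonneg: "0 \<le> x \<Longrightarrow> 0 \<le> \<theta> x"
begin

lemma mono: "x \<le> y \<Longrightarrow> \<theta> x \<le> \<theta> y"
  using nonneg[of "y - x"] by (simp add: diff)

text \<open>
  Along a sequence on which this fails, \<open>w\<^sub>i = (v\<^sub>i - K\<^sub>i z)\<^sup>+\<close> is almost disjoint from \<open>z\<close>, while convex
  combinations of the \<open>v\<^sub>i \<ge> w\<^sub>i\<close> come close to \<open>z\<close> in norm.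
\<close>

lemma weak_limit_excess_small:
  fixes v :: "nat \<Rightarrow> 'a"
  assumes lim: "limitin weak_topology v z sequentially" and v: "\<And>n. 0 \<le> v n" and e: "e > 0"
  shows "\<exists>K. \<forall>\<^sub>F k in sequentially. \<theta> (pprt (v k - real K *\<^sub>R z)) \<le> e"
proof (rule ccontr)
  assume "\<not> ?thesis"
  then have bad: "\<exists>\<^sub>F k in sequentially. e < \<theta> (pprt (v k - real K *\<^sub>R z))" for K
    by (simp add: not_eventually not_le)
  have z: "0 \<le> z" using lim v by (rule weak_limit_nonneg)
  have "convergent (\<lambda>k. \<theta> (v k))"
    using lim bounded_linear_axioms unfolding limitin_weak_topology_iff convergent_def by blast
  then obtain C where C: "C > 0" "\<And>k. norm (\<theta> (v k)) \<le> C"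
    using convergent_imp_Bseq BseqE by metis
  \<comment> \<open>Makes \<open>\<theta> (inf (w i) z)\<close> at most
    \<open>e / 2 ^ (i + 3)\<close>, which sums to \<open>e / 4\<close> over all \<open>i\<close>;
    \<open>Suc\<close> keeps \<open>K i\<close> positive for the divisions.\<close>
  define K where "K i = Suc (nat \<lceil>C * 2 ^ (i + 3) / e\<rceil>)" for i :: nat
  have K: "C / real (K i) \<le> e / 2 ^ (i + 3)" for i
  proof -
    have "C * 2 ^ (i + 3) / e \<le> real (K i)" unfolding K_def by linarith
    then show ?thesis using e by (simp add: field_simps K_def del: of_nat_Suc)
  qed
  have "\<exists>k\<ge>i. e < \<theta> (pprt (v k - real (K i) *\<^sub>R z))" for i
    using bad[of "K i"] unfolding frequently_sequentially by blast
  then obtain k where k: "\<And>i. k i \<ge> i" "\<And>i. e < \<theta> (pprt (v (k i) - real (K i) *\<^sub>R z))"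
    by metis
  define w where "w i = pprt (v (k i) - real (K i) *\<^sub>R z)" for i
  have w: "0 \<le> w i" "w i \<le> v (k i)" "\<theta> (inf (w i) z) \<le> e / 2 ^ (i + 3)" for i
  proof -
    show "0 \<le> w i" by (simp add: w_def)
    show "w i \<le> v (k i)"
      unfolding w_def using v z by (intro pprt_least) (simp_all add: scaleR_nonneg_nonneg)
    have "real (K i) * \<theta> (inf (w i) z) \<le> \<theta> (v (k i))"
      using mono[OF scaleR_inf_pprt_le[OF v z, of "K i" "k i"]] by (simp add: w_def scale)
    then have "\<theta> (inf (w i) z) \<le> C / real (K i)"
      using C(2)[of "k i"] by (simp add: field_simps K_def del: of_nat_Suc)
    then show "\<theta> (inf (w i) z) \<le> e / 2 ^ (i + 3)" using K[of i] by simp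
  qed
  \<comment> \<open>\<open>k\<close> may fail to be increasing; tending to infinity is enough to
    keep the weak limit.\<close>
  have "filterlim k at_top sequentially"
    by (intro filterlim_at_top_mono[OF filterlim_ident]) (simp add: k(1))
  then have "limitin weak_topology (\<lambda>i. v (k i)) z sequentially"
    using lim unfolding limitin_weak_topology_iff by (auto intro: filterlim_compose)
  then have zc: "z \<in> closure (convex hull (range (\<lambda>i. v (k i))))"
    by (rule weak_limit_in_closure_convex_hull)
  obtain B where B: "B > 0" "\<And>x. norm (\<theta> x) \<le> norm x * B" using pos_bounded by blast
  have "e / (4 * B) > 0" using e B by simp
  with zc obtain V where V: "V \<in> convex hull (range (\<lambda>i. v (k i)))" "dist V z < e / (4 * B)"
    unfolding closure_approachable by blast
  then obtain S u where S: "finite S" "S \<subseteq> range (\<lambda>i. v (k i))" "\<And>x. x \<in> S \<Longrightarrow> 0 \<le> u x"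
    "sum u S = 1" "(\<Sum>x\<in>S. u x *\<^sub>R x) = V"
    unfolding convex_hull_explicit by blast
  \<comment> \<open>One index per element of \<open>S\<close> gives an injective \<open>i\<close>,
    so the errors belong to distinct indices and are bounded by the geometric series.\<close>
  have "\<forall>x\<in>S. \<exists>i. v (k i) = x" using S(2) by blast
  then obtain i where i: "\<And>x. x \<in> S \<Longrightarrow> v (k (i x)) = x" by metis
  define W where "W = (\<Sum>x\<in>S. u x *\<^sub>R w (i x))"
  have "e \<le> \<theta> W"
  proof -
    have "e = (\<Sum>x\<in>S. u x * e)" using S(4) by (simp flip: sum_distrib_right)
    also have "\<dots> \<le> (\<Sum>x\<in>S. u x * \<theta> (w (i x)))"
      using S(3) k(2) by (intro sum_mono mult_left_mono) (auto simp: w_def less_imp_le)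
    also have "\<dots> = \<theta> W" by (simp add: W_def sum scale)
    finally show ?thesis .
  qed
  moreover have "\<theta> (inf W z) \<le> e / 4"
  proof -
    have "inf W z \<le> (\<Sum>x\<in>S. inf (u x *\<^sub>R w (i x)) z)"
      unfolding W_def using S z w(1) by (intro inf_sum_le scaleR_nonneg_nonneg) auto
    also have "\<dots> \<le> (\<Sum>x\<in>S. inf (w (i x)) z)"
    proof (intro sum_mono inf_mono order_refl)
      fix x assume x: "x \<in> S"
      have "u x \<le> 1" using member_le_sum[of x S u] x S by simp
      then show "u x *\<^sub>R w (i x) \<le> w (i x)"
        using scaleR_right_mono[OF _ w(1), of "u x" 1] by simp
    qed
    finally have "\<theta> (inf W z) \<le> \<theta> (\<Sum>x\<in>S. inf (w (i x)) z)" by (rule mono)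
    also have "\<dots> = (\<Sum>x\<in>S. \<theta> (inf (w (i x)) z))" by (rule sum)
    also have "\<dots> \<le> (\<Sum>x\<in>S. e / 2 ^ (i x + 3))" by (rule sum_mono) (rule w(3))
    also have "\<dots> = (\<Sum>j\<in>i ` S. e / 2 ^ (j + 3))"
      using i by (subst sum.reindex) (auto intro!: inj_on_inverseI[of _ "\<lambda>j. v (k j)"])
    also have "\<dots> = (\<Sum>j\<in>i ` S. e / 8 * (1 / 2) ^ j)"
      by (simp add: power_add power_one_over field_simps)
    also have "\<dots> \<le> (\<Sum>j. e / 8 * (1 / 2) ^ j)"
      using e S(1) by (intro sum_le_suminf summable_mult summable_geometric) auto
    also have "\<dots> = e / 4"
      by (subst suminf_mult) (simp_all add: suminf_geometric summable_geometric)
    finally show ?thesis .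
  qed
  moreover have "\<theta> (W - inf W z) < e / 4"
  proof -
    have "W \<le> V"
      unfolding W_def S(5)[symmetric]
    proof (intro sum_mono scaleR_left_mono S(3))
      fix x assume "x \<in> S"
      then show "w (i x) \<le> x" using w(2)[of "i x"] i by simp
    qed
    then have "W - inf W z \<le> pprt (V - z)"
      by (simp add: inf_eq_diff_pprt diff_right_mono del: diff_inf_eq_sup)
    then have "\<theta> (W - inf W z) \<le> norm (pprt (V - z)) * B"
      using mono B(2)[of "pprt (V - z)"] by fastforce
    also have "\<dots> \<le> norm (V - z) * B"
      using norm_pprt_le B(1) by (intro mult_right_mono) auto
    also have "\<dots> < e / 4"
      using V(2) B(1) by (simp add: dist_norm field_simps)
    finally show ?thesis .
  qed
  \<comment> \<open>The two parts of \<open>W\<close> contribute at most \<open>e / 4\<close> each,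
    against \<open>e \<le> \<theta> W\<close>.\<close>
  moreover have "\<theta> (W - inf W z) = \<theta> W - \<theta> (inf W z)" by (rule diff)
  ultimately show False using e by linarith
qed

end

section \<open>A convex surrogate for the Huber function\<close>

text \<open>The left side is the supremum of \<open>0\<close>, \<open>a + y\<close>,
  \<open>a - y\<close> and their sum \<open>a + a\<close>. The right side is above all four, because
  \<open>y\<close> and \<open>- y\<close> are below \<open>b\<close>.\<close>

lemma pprt_add_pprt_diff_mono:
  fixes a b y :: "'a::banach_lattice"
  assumes "\<bar>y\<bar> \<le> b"
  shows "pprt (a + y) + pprt (a - y) \<le> pprt (a + b) + pprt (a - b)"
proof -
  let ?R = "pprt (a + b) + pprt (a - b)"
  have yb: "y \<le> b" "- y \<le> b"
    using assms abs_ge_self[of y] abs_ge_minus_self[of y] by (auto intro: order_trans)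
  have ab: "a + b \<le> ?R" and R0: "0 \<le> ?R"
    using add_mono[OF le_pprt[of "a + b"] zero_le_pprt[of "a - b"]] by simp_all
  have "(a + b) + (a - b) \<le> ?R"
    by (intro add_mono le_pprt)
  then have "(a + y) + (a - y) \<le> ?R" by simp
  moreover have "a + y \<le> ?R" "a - y \<le> ?R"
    using order_trans[OF add_left_mono[OF yb(1), of a] ab]
      order_trans[OF add_left_mono[OF yb(2), of a] ab] by simp_all
  ultimately have R: "(a + y) + (a - y) \<le> ?R" "a + y \<le> ?R" "a - y \<le> ?R" "0 \<le> ?R"
    using R0 by simp_all
  have "pprt (a + y) \<le> ?R - pprt (a - y)"
  proof (rule pprt_least)
    have "pprt (a - y) \<le> ?R - (a + y)"
      using R by (intro pprt_least) (simp_all add: algebra_simps)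
    then show "a + y \<le> ?R - pprt (a - y)" by (simp add: algebra_simps)
    have "pprt (a - y) \<le> ?R" using R by (intro pprt_least)
    then show "0 \<le> ?R - pprt (a - y)" by simp
  qed
  then show ?thesis by (simp add: algebra_simps)
qed

text \<open>
  Up to an error governed by the part of \<open>y\<close> exceeding the grid size \<open>w\<close>, the second differences
  of \<open>\<Sum>i<M. pprt (x - i w)\<close> telescope.
\<close>

lemma pprt_grid_second_difference:
  fixes x y w :: "'a::banach_lattice"
  assumes w: "0 \<le> w"
  shows "(\<Sum>i<M. pprt (x - real i *\<^sub>R w + y) + pprt (x - real i *\<^sub>R w - y)
      - 2 *\<^sub>R pprt (x - real i *\<^sub>R w)) \<le> w + real M *\<^sub>R pprt (\<bar>y\<bar> - w)"
proof -
  define r where "r = pprt (\<bar>y\<bar> - w)"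
  define P where "P i = pprt (x + w - real i *\<^sub>R w)" for i
  have "pprt (a + y) + pprt (a - y) \<le> pprt (a + w) + pprt (a - w) + r" for a
  proof -
    have "\<bar>y\<bar> \<le> w + r" using le_pprt[of "\<bar>y\<bar> - w"] by (simp add: r_def algebra_simps)
    then have "pprt (a + y) + pprt (a - y) \<le> pprt (a + (w + r)) + pprt (a - (w + r))"
      by (rule pprt_add_pprt_diff_mono)
    also have "\<dots> \<le> (pprt (a + w) + r) + pprt (a - w)"
    proof (rule add_mono)
      have "0 \<le> r" by (simp add: r_def)
      then show "pprt (a - (w + r)) \<le> pprt (a - w)" by (intro pprt_mono) simp
      show "pprt (a + (w + r)) \<le> pprt (a + w) + r"
        using pprt_subadditive[of "a + w" r] \<open>0 \<le> r\<close> by (simp add: add.assoc)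
    qed
    finally show ?thesis by (simp add: algebra_simps)
  qed
  note le = this
  have P: "P i = pprt (x - real i *\<^sub>R w + w)" "P (i + 1) = pprt (x - real i *\<^sub>R w)"
    "P (i + 2) = pprt (x - real i *\<^sub>R w - w)" for i
    by (simp_all add: P_def algebra_simps scaleR_2)
  have "pprt (x - real i *\<^sub>R w + y) + pprt (x - real i *\<^sub>R w - y)
      - 2 *\<^sub>R pprt (x - real i *\<^sub>R w) \<le> P i + P (i + 2) - 2 *\<^sub>R P (i + 1) + r" for i
    \<comment> \<open>\<open>P(1)\<close> is unfolded last, since its left side matches every
      application of \<open>P\<close>.\<close>
    using diff_right_mono[OF le[of "x - real i *\<^sub>R w"], of "2 *\<^sub>R pprt (x - real i *\<^sub>R w)"]
    unfolding P(3) unfolding P(2) unfolding P(1) by (simp add: algebra_simps)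
  then have "(\<Sum>i<M. pprt (x - real i *\<^sub>R w + y) + pprt (x - real i *\<^sub>R w - y)
      - 2 *\<^sub>R pprt (x - real i *\<^sub>R w)) \<le> (\<Sum>i<M. P i + P (i + 2) - 2 *\<^sub>R P (i + 1) + r)"
    by (rule sum_mono)
  also have "\<dots> = (P 0 - P 1) - (P M - P (M + 1)) + real M *\<^sub>R r"
    by (induction M) (simp_all add: algebra_simps scaleR_2)
  also have "\<dots> \<le> w + real M *\<^sub>R r"
  proof -
    have "P 0 \<le> P 1 + w"
      using pprt_subadditive[of x w] w by (simp add: P_def)
    moreover have "P (M + 1) \<le> P M"
      unfolding P_def using w by (intro pprt_mono) (simp add: algebra_simps)
    ultimately have "(P 0 - P 1) - (P M - P (M + 1)) \<le> w - 0"
      by (intro diff_mono) (simp_all add: algebra_simps)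
    then show ?thesis by simp
  qed
  finally show ?thesis by (simp add: r_def)
qed

context positive_functional
begin

text \<open>A surrogate for the Huber function: convex, of slope at most \<open>2 M\<close>, quadratic at the scale \<open>w\<close>.\<close>

definition grid :: "nat \<Rightarrow> 'a \<Rightarrow> 'a \<Rightarrow> real" where
  "grid M w x = (\<Sum>i<M. \<theta> (pprt (x - real i *\<^sub>R w)) + \<theta> (pprt (- x - real i *\<^sub>R w)))"

lemma grid_0: "0 \<le> w \<Longrightarrow> grid M w 0 = 0"
  unfolding grid_def by (rule sum.neutral) (simp add: scaleR_nonneg_nonneg zero)

lemma pprt_diff_scaleR_convex:
  assumes "0 < t" "t < 1"
  shows "\<theta> (pprt ((1 - t) *\<^sub>R x + t *\<^sub>R y - c)) \<le> (1 - t) * \<theta> (pprt (x - c)) + t * \<theta> (pprt (y - c))"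
proof -
  have "(1 - t) *\<^sub>R x + t *\<^sub>R y - c = (1 - t) *\<^sub>R (x - c) + t *\<^sub>R (y - c)"
    by (simp add: algebra_simps)
  then have "pprt ((1 - t) *\<^sub>R x + t *\<^sub>R y - c) \<le> (1 - t) *\<^sub>R pprt (x - c) + t *\<^sub>R pprt (y - c)"
    using pprt_subadditive[of "(1 - t) *\<^sub>R (x - c)" "t *\<^sub>R (y - c)"] assms by (simp add: pprt_scaleR)
  from mono[OF this] show ?thesis by (simp add: add scale)
qed

lemma convex_on_grid: "convex_on UNIV (grid M w)"
proof (rule convex_onI)
  fix t :: real and x y :: 'a assume t: "0 < t" "t < 1"
  have "\<theta> (pprt ((1 - t) *\<^sub>R x + t *\<^sub>R y - c)) + \<theta> (pprt (- ((1 - t) *\<^sub>R x + t *\<^sub>R y) - c)) \<le>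
      (1 - t) * (\<theta> (pprt (x - c)) + \<theta> (pprt (- x - c))) + t * (\<theta> (pprt (y - c)) + \<theta> (pprt (- y - c)))" for c
    using pprt_diff_scaleR_convex[OF t, of x y c] pprt_diff_scaleR_convex[OF t, of "- x" "- y" c]
    by (simp add: distrib_left)
  then show "grid M w ((1 - t) *\<^sub>R x + t *\<^sub>R y) \<le> (1 - t) * grid M w x + t * grid M w y"
    unfolding grid_def sum_distrib_left sum.distrib[symmetric] by (rule sum_mono)
qed simp

text \<open>Each of the \<open>2 M\<close> positive parts grows by at most
  \<open>\<theta> \<bar>y\<bar>\<close>.\<close>

lemma grid_add_le: "grid M w (x + y) \<le> grid M w x + 2 * real M * \<theta> \<bar>y\<bar>"
proof -
  have le: "\<theta> (pprt (a + y)) \<le> \<theta> (pprt a) + \<theta> \<bar>y\<bar>" for a y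
    using mono[OF order_trans[OF pprt_subadditive[of a y] add_left_mono[OF pprt_le_abs]]]
    by (simp add: add)
  have "\<theta> (pprt (x + y - c)) + \<theta> (pprt (- (x + y) - c)) \<le>
      \<theta> (pprt (x - c)) + \<theta> (pprt (- x - c)) + 2 * \<theta> \<bar>y\<bar>" for c
  proof -
    have "x + y - c = (x - c) + y" "- (x + y) - c = (- x - c) + (- y)"
      by simp_all
    then show ?thesis
      using le[of "x - c" y] le[of "- x - c" "- y"] by (simp only: abs_minus_cancel)
  qed
  then have "grid M w (x + y) \<le>
      (\<Sum>i<M. \<theta> (pprt (x - real i *\<^sub>R w)) + \<theta> (pprt (- x - real i *\<^sub>R w)) + 2 * \<theta> \<bar>y\<bar>)"
    unfolding grid_def by (rule sum_mono)
  also have "\<dots> = grid M w x + 2 * real M * \<theta> \<bar>y\<bar>"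
    by (simp add: grid_def sum.distrib)
  finally show ?thesis .
qed

lemma grid_second_difference:
  assumes "0 \<le> w"
  shows "grid M w (x + y) + grid M w (x - y) - 2 * grid M w x \<le>
    2 * \<theta> w + 2 * real M * \<theta> (pprt (\<bar>y\<bar> - w))"
proof -
  let ?D = "\<lambda>x i. pprt (x - real i *\<^sub>R w + y) + pprt (x - real i *\<^sub>R w - y)
      - 2 *\<^sub>R pprt (x - real i *\<^sub>R w)"
  have "grid M w (x + y) + grid M w (x - y) - 2 * grid M w x =
      \<theta> (\<Sum>i<M. ?D x i) + \<theta> (\<Sum>i<M. ?D (- x) i)"
    unfolding grid_def sum sum_distrib_left sum.distrib[symmetric] sum_subtractf[symmetric]
    by (rule sum.cong) (simp_all add: add diff scale algebra_simps)
  also have "\<dots> \<le> 2 * \<theta> (w + real M *\<^sub>R pprt (\<bar>y\<bar> - w))"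
    using mono[OF pprt_grid_second_difference[OF assms, where M = M and x = x and y = y]]
      mono[OF pprt_grid_second_difference[OF assms, where M = M and x = "- x" and y = y]] by linarith
  finally show ?thesis by (simp add: add scale algebra_simps)
qed

text \<open>Converts bounds on \<open>grid\<close> back into bounds on the seminorm:
  \<open>\<bar>x\<bar>\<close> exceeds the sum of its two truncations at level \<open>i w\<close> by
  at most \<open>i w\<close>, and there are \<open>M\<close> levels with
  \<open>i < M\<close>.\<close>

lemma grid_lower:
  assumes "0 \<le> w"
  shows "real M * \<theta> \<bar>x\<bar> \<le> grid M w x + real M * real M * \<theta> w"
proof -
  have "\<theta> \<bar>x\<bar> \<le> \<theta> (pprt (x - real i *\<^sub>R w)) + \<theta> (pprt (- x - real i *\<^sub>R w)) + real M * \<theta> w"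
    if "i < M" for i
  proof -
    let ?c = "real i *\<^sub>R w"
    have c: "0 \<le> ?c" using assms by (simp add: scaleR_nonneg_nonneg)
    have "\<bar>x\<bar> \<le> pprt (x - ?c) + pprt (- x - ?c) + ?c"
    proof (rule abs_leI)
      have "(x - ?c) + 0 \<le> pprt (x - ?c) + pprt (- x - ?c)" by (intro add_mono le_pprt) simp
      then show "x \<le> pprt (x - ?c) + pprt (- x - ?c) + ?c" by (simp add: algebra_simps)
      have "0 + (- x - ?c) \<le> pprt (x - ?c) + pprt (- x - ?c)" by (intro add_mono le_pprt) simp
      then show "- x \<le> pprt (x - ?c) + pprt (- x - ?c) + ?c" by (simp add: algebra_simps)
    qed
    from mono[OF this]
    have "\<theta> \<bar>x\<bar> \<le> \<theta> (pprt (x - ?c)) + \<theta> (pprt (- x - ?c)) + real i * \<theta> w"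
      by (simp add: add scale)
    moreover have "real i * \<theta> w \<le> real M * \<theta> w"
      using that nonneg[OF assms] by (intro mult_right_mono) simp_all
    ultimately show ?thesis by linarith
  qed
  then have "(\<Sum>i<M. \<theta> \<bar>x\<bar>) \<le>
      (\<Sum>i<M. \<theta> (pprt (x - real i *\<^sub>R w)) + \<theta> (pprt (- x - real i *\<^sub>R w)) + real M * \<theta> w)"
    by (intro sum_mono) simp
  then show ?thesis by (simp add: grid_def sum.distrib)
qed

lemma grid_subgradient:
  obtains g where "bounded_linear g" "\<And>y. g y \<le> grid M w (x + y) - grid M w x"
proof -
  obtain B where B: "B > 0" "\<And>x. norm (\<theta> x) \<le> norm x * B" using pos_bounded by blast
  have "grid M w (a + y) \<le> grid M w a + (2 * real M * B) * norm y" for a y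
  proof -
    have "\<theta> \<bar>y\<bar> \<le> norm y * B" using B(2)[of "\<bar>y\<bar>"] by simp
    then have "2 * real M * \<theta> \<bar>y\<bar> \<le> 2 * real M * (norm y * B)" by (intro mult_left_mono) simp_all
    then show ?thesis using grid_add_le[of M w a y] by (simp add: mult_ac)
  qed
  from convex_subgradient[OF convex_on_grid this] show thesis using that by blast
qed

text \<open>The subgradient inequality at \<open>- y\<close> bounds \<open>grid M w (x - y)\<close>
  from below. The second difference then controls the forward increment, up to the linear term
  \<open>g y\<close>.\<close>

lemma grid_step:
  assumes "0 \<le> w" "linear g" "\<And>y. g y \<le> grid M w (x + y) - grid M w x"
  shows "grid M w (x + y) \<le> grid M w x + g y + 2 * \<theta> w + 2 * real M * \<theta> (pprt (\<bar>y\<bar> - w))"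
  using grid_second_difference[OF assms(1), of M x y] assms(3)[of "- y"] linear_neg[OF assms(2), of y]
  by simp

end

section \<open>Cesaro means\<close>

lemma cesaro_null:
  fixes a :: "nat \<Rightarrow> real"
  assumes "a \<longlonglongrightarrow> 0"
  shows "(\<lambda>n. (1 / real n) * (\<Sum>k<n. a k)) \<longlonglongrightarrow> 0"
proof (rule LIMSEQ_I)
  fix e :: real assume e: "e > 0"
  then obtain m where m: "\<And>k. k \<ge> m \<Longrightarrow> norm (a k) < e / 2"
    using LIMSEQ_D[OF assms, of "e / 2"] by auto
  define A where "A = (\<Sum>k<m. \<bar>a k\<bar>)"
  have bound: "\<bar>\<Sum>k<n. a k\<bar> \<le> A + real n * (e / 2)" for n
  proof -
    have "\<bar>\<Sum>k<n. a k\<bar> \<le> (\<Sum>k<n. \<bar>a k\<bar>)" by (rule sum_abs)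
    also have "\<dots> \<le> (\<Sum>k<n. (if k < m then \<bar>a k\<bar> else 0) + e / 2)"
      using m e by (intro sum_mono) (auto simp: not_less intro: less_imp_le)
    also have "\<dots> = (\<Sum>k<n. if k < m then \<bar>a k\<bar> else 0) + real n * (e / 2)"
      by (simp add: sum.distrib)
    also have "(\<Sum>k<n. if k < m then \<bar>a k\<bar> else 0) = (\<Sum>k\<in>{..<n} \<inter> {..<m}. \<bar>a k\<bar>)"
      by (simp add: sum.If_cases lessThan_def)
    also have "\<dots> \<le> A" unfolding A_def by (rule sum_mono2) auto
    finally show ?thesis by simp
  qed
  obtain N :: nat where N: "2 * A / e < real N" using reals_Archimedean2 by blast
  have "norm ((1 / real n) * (\<Sum>k<n. a k) - 0) < e" if n: "n \<ge> Suc N" for n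
  proof -
    have "2 * A < e * real N" using N e by (simp add: field_simps)
    also have "\<dots> \<le> e * real n" using n e by (intro mult_left_mono) simp_all
    finally have "\<bar>\<Sum>k<n. a k\<bar> < real n * e" using bound[of n] by (simp add: algebra_simps)
    then show ?thesis using n by (simp add: abs_mult field_simps)
  qed
  then show "\<exists>N. \<forall>n\<ge>N. norm ((1 / real n) * (\<Sum>k<n. a k) - 0) < e" by blast
qed

text \<open>Beyond an initial segment, \<open>grid\<close> of the partial sums grows by at most
  \<open>3 M e\<close> per step. Its asymptotic slope being of order \<open>M\<close>, division by
  \<open>M\<close> bounds the seminorm of the sums by a constant plus \<open>3 e n\<close>.\<close>

lemma (in positive_functional) hereditary_Banach_Saks:
  fixes x :: "nat \<Rightarrow> 'a"
  assumes x: "limitin weak_topology x 0 sequentially"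
    and ax: "limitin weak_topology (\<lambda>k. \<bar>x k\<bar>) z sequentially"
  obtains b :: "nat \<Rightarrow> nat" where "strict_mono b"
    "\<And>r. strict_mono r \<Longrightarrow> (\<lambda>n. \<theta> \<bar>(1 / real n) *\<^sub>R (\<Sum>k<n. x (b (r k)))\<bar>) \<longlonglongrightarrow> 0"
proof -
  have z: "0 \<le> z" using ax by (rule weak_limit_nonneg) simp
  then have Kz: "0 \<le> real K *\<^sub>R z" for K by (simp add: scaleR_nonneg_nonneg)
  have "\<exists>g. bounded_linear g \<and> (\<forall>y. g y \<le> grid M (real K *\<^sub>R z) (s + y) - grid M (real K *\<^sub>R z) s)"
    for M K s by (rule grid_subgradient) blast
  then obtain G where G: "\<And>M K s. bounded_linear (G M K s)"
    "\<And>M K s y. G M K s y \<le> grid M (real K *\<^sub>R z) (s + y) - grid M (real K *\<^sub>R z) s"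
    by metis
  \<comment> \<open>Admitting all subsets of \<open>{..m}\<close> provides for every further
    subsequence. Only finitely many functionals occur, and each tends to 0 along
    \<open>x\<close>.\<close>
  have "\<exists>N. \<forall>n\<ge>N. \<forall>A\<in>Pow {..m}. \<forall>M\<in>{..m}. \<forall>K\<in>{..m}. G M K (sum x A) (x n) \<le> 1" for m
  proof -
    have "\<forall>\<^sub>F n in sequentially. G M K s (x n) \<le> 1" for M K s
    proof -
      have "(\<lambda>n. G M K s (x n)) \<longlonglongrightarrow> G M K s 0"
        using x G(1) by (simp add: limitin_weak_topology_iff)
      then have "(\<lambda>n. G M K s (x n)) \<longlonglongrightarrow> 0"
        using linear_0[OF bounded_linear.linear[OF G(1)]] by simp
      then have "\<forall>\<^sub>F n in sequentially. G M K s (x n) < 1"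
        by (rule order_tendstoD) simp
      then show ?thesis by (rule eventually_mono) simp
    qed
    then have "\<forall>\<^sub>F n in sequentially. \<forall>A\<in>Pow {..m}. \<forall>M\<in>{..m}. \<forall>K\<in>{..m}. G M K (sum x A) (x n) \<le> 1"
      by (intro eventually_ball_finite ballI) simp_all
    then show ?thesis unfolding eventually_sequentially .
  qed
  then obtain N where N: "\<And>m n A M K. n \<ge> N m \<Longrightarrow> A \<subseteq> {..m} \<Longrightarrow> M \<le> m \<Longrightarrow> K \<le> m \<Longrightarrow>
      G M K (sum x A) (x n) \<le> 1"
    by (metis PowI atMost_iff)
  define b where "b = rec_nat 0 (\<lambda>_ m. max (Suc m) (N m))"
  have b_Suc: "b (Suc j) = max (Suc (b j)) (N (b j))" for j by (simp add: b_def)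
  have b: "strict_mono b"
    unfolding strict_mono_Suc_iff by (simp add: b_Suc less_max_iff_disj)
  show thesis
  proof (rule that[OF b])
    fix r :: "nat \<Rightarrow> nat" assume r: "strict_mono r"
    define y where "y k = x (b (r k))" for k
    define S where "S n = (\<Sum>k<n. y k)" for n
    have S_Suc: "S (Suc k) = S k + y k" for k by (simp add: S_def)
    \<comment> \<open>Here \<open>k > 0\<close>. With \<open>r k = Suc m\<close> all earlier indices
      satisfy \<open>r i \<le> m\<close>, so \<open>S k\<close> sums over a subset of
      \<open>{..b m}\<close>, while \<open>b (r k) \<ge> N (b m)\<close>.\<close>
    have select: "G M K (S k) (y k) \<le> 1" if "M < k" "K < k" for M K k
    proof -
      obtain k' where k': "k = Suc k'" using \<open>M < k\<close> by (metis not0_implies_Suc not_less_zero)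
      have "r k' < r k" using r k' by (simp add: strict_mono_def)
      then obtain m where m: "r k = Suc m" "r k' \<le> m" by (cases "r k") auto
      have "k' \<le> m" using m(2) seq_suble[OF r, of k'] by simp
      also have "m \<le> b m" using seq_suble[OF b] .
      finally have MK: "M \<le> b m" "K \<le> b m" using that k' by simp_all
      have "(\<lambda>i. b (r i)) ` {..<k} \<subseteq> {..b m}"
      proof safe
        fix i assume "i < k"
        then have "r i \<le> m" using m(2) k' r by (meson less_Suc_eq_le order_trans strict_mono_less_eq)
        then show "b (r i) \<le> b m" using b by (simp add: strict_mono_less_eq)
      qed
      moreover have "sum x ((\<lambda>i. b (r i)) ` {..<k}) = S k"
      proof -
        have "inj_on (\<lambda>i. b (r i)) {..<k}"
          using strict_mono_imp_inj_on[OF strict_mono_o[OF b r]] by (simp add: inj_on_def)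
        then show ?thesis by (simp add: sum.reindex S_def y_def)
      qed
      moreover have "b (r k) \<ge> N (b m)" by (simp add: m b_Suc)
      ultimately show ?thesis using N[OF _ _ MK] unfolding y_def by metis
    qed
    have "convergent (\<lambda>k. \<theta> \<bar>x k\<bar>)"
      using ax bounded_linear_axioms unfolding limitin_weak_topology_iff convergent_def by blast
    then obtain C where C: "C > 0" "\<And>k. norm (\<theta> \<bar>x k\<bar>) \<le> C"
      using convergent_imp_Bseq BseqE by metis
    show "(\<lambda>n. \<theta> \<bar>(1 / real n) *\<^sub>R (\<Sum>k<n. x (b (r k)))\<bar>) \<longlonglongrightarrow> 0"
    proof (rule LIMSEQ_I)
      fix \<epsilon> :: real assume "\<epsilon> > 0"
      define e where "e = \<epsilon> / 5"
      have e: "e > 0" "4 * e < \<epsilon>" using \<open>\<epsilon> > 0\<close> by (simp_all add: e_def)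
      obtain K k0 where K: "\<And>k. k \<ge> k0 \<Longrightarrow> \<theta> (pprt (\<bar>x k\<bar> - real K *\<^sub>R z)) \<le> e"
        using weak_limit_excess_small[OF ax abs_ge_zero e(1)] unfolding eventually_sequentially by metis
      define w where "w = real K *\<^sub>R z"
      have w: "0 \<le> w" "0 \<le> \<theta> w" using Kz nonneg by (simp_all add: w_def)
      \<comment> \<open>After division by \<open>M\<close>, the fixed increment
        \<open>1 + 2 * \<theta> w\<close> costs at most \<open>e\<close> per step.\<close>
      obtain M :: nat where "(1 + 2 * \<theta> w) / e < real M" using reals_Archimedean2 by blast
      then have M: "1 + 2 * \<theta> w \<le> real M * e" using e by (simp add: field_simps)
      then have M0: "M > 0" using w(2) by (cases M) auto
      \<comment> \<open>From \<open>q\<close> on, both the selection of the subsequence and the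
        excess bound apply; the first \<open>q\<close> steps use the crude Lipschitz
        estimate.\<close>
      define q where "q = M + K + k0 + 1"
      define I where "I = 1 + 2 * \<theta> w + 2 * real M * e"
      have I0: "0 \<le> I" using w(2) e by (simp add: I_def)
      have step: "grid M w (S (Suc k)) \<le> grid M w (S k) + (if k < q then 2 * real M * C else 0) + I" for k
      proof (cases "k < q")
        case True
        have "grid M w (S (Suc k)) \<le> grid M w (S k) + 2 * real M * \<theta> \<bar>y k\<bar>"
          unfolding S_Suc by (rule grid_add_le)
        also have "2 * real M * \<theta> \<bar>y k\<bar> \<le> 2 * real M * C"
          using C(2)[of "b (r k)"] by (intro mult_left_mono) (simp_all add: y_def)
        finally show ?thesis using True I0 by simp
      next
        case False
        have "b (r k) \<ge> k" using seq_suble[OF strict_mono_o[OF b r], of k] by simp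
        then have "\<theta> (pprt (\<bar>y k\<bar> - w)) \<le> e"
          unfolding y_def w_def using False by (intro K) (simp add: q_def)
        then have "2 * real M * \<theta> (pprt (\<bar>y k\<bar> - w)) \<le> 2 * real M * e"
          by (intro mult_left_mono) simp_all
        moreover have "G M K (S k) (y k) \<le> 1"
          using False by (intro select) (simp_all add: q_def)
        moreover have "grid M w (S (Suc k)) \<le>
            grid M w (S k) + G M K (S k) (y k) + 2 * \<theta> w + 2 * real M * \<theta> (pprt (\<bar>y k\<bar> - w))"
          unfolding S_Suc w_def using G by (intro grid_step Kz bounded_linear.linear)
        ultimately show ?thesis using False by (simp add: I_def)
      qed
      have bound: "grid M w (S n) \<le> real (min n q) * (2 * real M * C) + real n * I" for n
      proof (induction n)
        case 0
        show ?case using grid_0[OF w(1)] by (simp add: S_def)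
      next
        case (Suc n)
        have "real (min (Suc n) q) * (2 * real M * C) =
            real (min n q) * (2 * real M * C) + (if n < q then 2 * real M * C else 0)"
          by (auto simp: min_def algebra_simps not_le less_Suc_eq_le)
        then show ?case using Suc step[of n] by (simp add: algebra_simps)
      qed
      define D where "D = 2 * real q * C + real M * \<theta> w"
      have S_bound: "\<theta> \<bar>S n\<bar> \<le> D + 3 * e * real n" for n
      proof -
        have "real M * \<theta> \<bar>S n\<bar> \<le> grid M w (S n) + real M * real M * \<theta> w"
          by (rule grid_lower[OF w(1)])
        also have "grid M w (S n) \<le> real (min n q) * (2 * real M * C) + real n * I" by (rule bound)
        also have "real (min n q) * (2 * real M * C) \<le> real q * (2 * real M * C)"
          using C(1) by (intro mult_right_mono) auto
        also have "real n * I \<le> real n * (3 * (real M * e))"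
          using M by (intro mult_left_mono) (simp_all add: I_def algebra_simps)
        finally have "real M * \<theta> \<bar>S n\<bar> \<le> real M * (D + 3 * e * real n)"
          by (simp add: D_def algebra_simps)
        then show ?thesis using M0 by simp
      qed
      obtain n0 :: nat where n0: "D / e < real n0" using reals_Archimedean2 by blast
      have "norm (\<theta> \<bar>(1 / real n) *\<^sub>R (\<Sum>k<n. x (b (r k)))\<bar> - 0) < \<epsilon>" if n: "n \<ge> Suc n0" for n
      proof -
        have "D < e * real n0" using n0 e by (simp add: field_simps)
        also have "\<dots> \<le> e * real n" using n e by (intro mult_left_mono) simp_all
        finally have "\<theta> \<bar>S n\<bar> \<le> 4 * e * real n" using S_bound[of n] by simp
        then have "(1 / real n) * \<theta> \<bar>S n\<bar> \<le> 4 * e" using n by (simp add: field_simps)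
        moreover have "\<theta> \<bar>(1 / real n) *\<^sub>R S n\<bar> = (1 / real n) * \<theta> \<bar>S n\<bar>"
          by (simp only: abs_scaleR_lattice scale) simp
        moreover have "0 \<le> \<theta> \<bar>(1 / real n) *\<^sub>R S n\<bar>" by (intro nonneg) simp
        ultimately show ?thesis using e(2) by (simp add: S_def y_def)
      qed
      then show "\<exists>n0. \<forall>n\<ge>n0. norm (\<theta> \<bar>(1 / real n) *\<^sub>R (\<Sum>k<n. x (b (r k)))\<bar> - 0) < \<epsilon>" by blast
    qed
  qed
qed

text \<open>Identifies the limit: a functional maps the means to Cesaro means of a scalar null
  sequence, so every functional vanishes at the norm limit.\<close>

lemma bounded_linear_cesaro_null:
  fixes T :: "'a::real_normed_vector \<Rightarrow> 'b::real_normed_vector"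
  assumes T: "bounded_linear T" and u: "limitin weak_topology u 0 sequentially"
    and conv: "convergent (\<lambda>n. (1 / real n) *\<^sub>R (\<Sum>k<n. T (u k)))"
  shows "(\<lambda>n. (1 / real n) *\<^sub>R (\<Sum>k<n. T (u k))) \<longlonglongrightarrow> 0"
proof -
  obtain L where L: "(\<lambda>n. (1 / real n) *\<^sub>R (\<Sum>k<n. T (u k))) \<longlonglongrightarrow> L"
    using conv by (auto simp: convergent_def)
  have "g L = g 0" if g: "bounded_linear g" for g :: "'b \<Rightarrow> real"
  proof -
    interpret g: bounded_linear g by fact
    interpret gT: bounded_linear "\<lambda>x. g (T x)"
      using bounded_linear_compose[OF g T] .
    have "(\<lambda>k. g (T (u k))) \<longlonglongrightarrow> g (T 0)"
      using u[unfolded limitin_weak_topology_iff, rule_format, OF gT.bounded_linear_axioms] .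
    then have "(\<lambda>n. (1 / real n) * (\<Sum>k<n. g (T (u k)))) \<longlonglongrightarrow> 0"
      using gT.zero by (intro cesaro_null) simp
    moreover have "(\<lambda>n. g ((1 / real n) *\<^sub>R (\<Sum>k<n. T (u k)))) \<longlonglongrightarrow> g L"
      by (rule g.tendsto[OF L])
    ultimately show ?thesis
      by (simp add: g.scale g.sum g.zero LIMSEQ_unique)
  qed
  then have "L = 0" by (rule weakly_separated)
  with L show ?thesis by simp
qed

lemma limitin_weak_topology_subseq:
  fixes x :: "nat \<Rightarrow> 'a::real_normed_vector"
  assumes x: "limitin weak_topology x l sequentially" and a: "strict_mono a"
  shows "limitin weak_topology (\<lambda>k. x (a k)) l sequentially"
  unfolding limitin_weak_topology_iff
proof (intro allI impI)
  fix f :: "'a \<Rightarrow> real" assume "bounded_linear f"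
  with x have "(\<lambda>n. f (x n)) \<longlonglongrightarrow> f l" by (simp add: limitin_weak_topology_iff)
  from LIMSEQ_subseq_LIMSEQ[OF this a] show "(\<lambda>k. f (x (a k))) \<longlonglongrightarrow> f l" by (simp add: o_def)
qed

section \<open>Domination: passing from \<open>T\<close> to \<open>S\<close>\<close>

theorem theorem6p20:
  fixes S T :: "'a::banach_lattice \<Rightarrow> 'b::banach_lattice"
  assumes "W1_property TYPE('a)"
    and "order_continuous TYPE('b)"
    and "linear S" and "linear T"
    and "\<And>x. 0 \<le> x \<Longrightarrow> 0 \<le> S x \<and> S x \<le> T x"
    and "weakly_Banach_Saks T"
  shows "weakly_Banach_Saks S"
  unfolding weakly_Banach_Saks_def
proof (intro allI impI)
  fix x :: "nat \<Rightarrow> 'a" assume x: "limitin weak_topology x 0 sequentially"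
  have S: "0 \<le> S v" and ST: "S v \<le> T v" and T: "0 \<le> T v" if "0 \<le> v" for v
    using assms(5)[OF that] by auto
  have T_bl: "bounded_linear T"
    using assms(4) T by (rule positive_imp_bounded_linear)
  have "relatively_weakly_compact (range (\<lambda>n. \<bar>x n\<bar>))"
    using assms(1) relatively_weakly_compact_range[OF x] unfolding W1_property_def by (metis image_image)
  then obtain a z where a: "strict_mono a" "limitin weak_topology ((\<lambda>n. \<bar>x n\<bar>) \<circ> a) z sequentially"
    by (rule relatively_weakly_compact_subsequence)
  have z: "0 \<le> z" using a(2) by (rule weak_limit_nonneg) simp
  obtain f :: "'b \<Rightarrow> real" where f: "bounded_linear f" "\<And>v. 0 \<le> v \<Longrightarrow> 0 \<le> f v"
    "\<And>w. (\<And>n. 0 \<le> w n) \<Longrightarrow> (\<And>n. w n \<le> T z) \<Longrightarrow> (\<lambda>n. f (w n)) \<longlonglongrightarrow> 0 \<Longrightarrow> w \<longlonglongrightarrow> 0"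
    using order_continuous_dominating_functional[OF assms(2), of "T z"] by metis
  interpret f: positive_functional f
    using f by (simp add: positive_functional_def positive_functional_axioms_def)
  interpret fT: positive_functional "\<lambda>v. f (T v)"
    using bounded_linear_compose[OF f(1) T_bl] f(2) T
    by (simp add: positive_functional_def positive_functional_axioms_def)
  have xa: "limitin weak_topology (\<lambda>k. x (a k)) 0 sequentially"
    using x a(1) by (rule limitin_weak_topology_subseq)
  have "\<exists>b :: nat \<Rightarrow> nat. strict_mono b \<and> (\<forall>r. strict_mono r \<longrightarrow>
      (\<lambda>n. f (T \<bar>(1 / real n) *\<^sub>R (\<Sum>k<n. x (a (b (r k))))\<bar>)) \<longlonglongrightarrow> 0)"
  proof (rule fT.hereditary_Banach_Saks[OF xa a(2)[unfolded o_def]])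
    fix b :: "nat \<Rightarrow> nat"
    assume b: "strict_mono b" and null: "\<And>r. strict_mono r \<Longrightarrow>
      (\<lambda>n. f (T \<bar>(1 / real n) *\<^sub>R (\<Sum>k<n. x (a (b (r k))))\<bar>)) \<longlonglongrightarrow> 0"
    show ?thesis by (intro exI[of _ b] conjI allI impI b null)
  qed
  then obtain b :: "nat \<Rightarrow> nat" where b: "strict_mono b" and
    null: "\<forall>r. strict_mono r \<longrightarrow>
      (\<lambda>n. f (T \<bar>(1 / real n) *\<^sub>R (\<Sum>k<n. x (a (b (r k))))\<bar>)) \<longlonglongrightarrow> 0"
    by (elim exE conjE)
  have u: "limitin weak_topology (\<lambda>k. \<bar>x (a (b k))\<bar> - z) 0 sequentially"
    unfolding limitin_weak_topology_iff
  proof (intro allI impI)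
    fix g :: "'a \<Rightarrow> real" assume g: "bounded_linear g"
    have "(\<lambda>k. g \<bar>x (a k)\<bar>) \<longlonglongrightarrow> g z"
      using a(2) g by (simp add: limitin_weak_topology_iff)
    from LIMSEQ_subseq_LIMSEQ[OF this b] have "(\<lambda>k. g \<bar>x (a (b k))\<bar> - g z) \<longlonglongrightarrow> 0"
      by (simp add: o_def LIM_zero)
    then show "(\<lambda>k. g (\<bar>x (a (b k))\<bar> - z)) \<longlonglongrightarrow> g 0"
      using bounded_linear.linear[OF g] by (simp add: linear_diff linear_0)
  qed
  \<comment> \<open>The further subsequence \<open>r\<close> depends on \<open>T\<close>;
    \<open>null\<close> holds along it because it was obtained for all further subsequences.\<close>
  from assms(6)[unfolded weakly_Banach_Saks_def, rule_format, OF this]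
  obtain r :: "nat \<Rightarrow> nat" where r: "strict_mono r"
    "convergent (\<lambda>n. (1 / real n) *\<^sub>R (\<Sum>k<n. T (\<bar>x (a (b (r k)))\<bar> - z)))"
    by (elim exE conjE)
  define l where "l n = (1 / real n) *\<^sub>R (\<Sum>k<n. T (\<bar>x (a (b (r k)))\<bar> - z))" for n
  define t where "t n = (1 / real n) *\<^sub>R (\<Sum>k<n. x (a (b (r k))))" for n
  have "limitin weak_topology (\<lambda>k. \<bar>x (a (b (r k)))\<bar> - z) 0 sequentially"
    using u r(1) by (rule limitin_weak_topology_subseq)
  from bounded_linear_cesaro_null[OF T_bl this r(2)] have l: "l \<longlonglongrightarrow> 0"
    by (simp add: l_def[abs_def])
  have St_le_Tt: "\<bar>S (t n)\<bar> \<le> T \<bar>t n\<bar>" for n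
    using positive_abs_le[OF assms(3) S, of "t n"] ST[of "\<bar>t n\<bar>"] by (auto intro: order_trans)
  have St_le: "\<bar>S (t n)\<bar> \<le> T z + \<bar>l n\<bar>" for n
  proof -
    interpret T: bounded_linear T by (rule T_bl)
    have "\<bar>t n\<bar> \<le> (1 / real n) *\<^sub>R (\<Sum>k<n. \<bar>x (a (b (r k)))\<bar>)"
      unfolding t_def abs_scaleR_lattice by (simp add: scaleR_left_mono sum_abs)
    then have "T \<bar>t n\<bar> \<le> T ((1 / real n) *\<^sub>R (\<Sum>k<n. \<bar>x (a (b (r k)))\<bar>))"
      by (intro positive_mono[OF assms(4)] T)
    also have "\<dots> = (1 / real n) *\<^sub>R (\<Sum>k<n. T \<bar>x (a (b (r k)))\<bar>)"
      by (simp only: T.scale T.sum)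
    \<comment> \<open>For \<open>n = 0\<close> the means are 0 because \<open>1 / 0 = 0\<close>, and
      the bound reduces to \<open>0 \<le> T z\<close>.\<close>
    also have "\<dots> \<le> T z + l n"
      using T[OF z] by (cases "n = 0") (simp_all add: l_def T.diff sum_subtractf scaleR_diff_right sum_constant_scaleR)
    also have "\<dots> \<le> T z + \<bar>l n\<bar>" by (simp add: abs_ge_self)
    finally show ?thesis using St_le_Tt[of n] by (rule order_trans[rotated])
  qed
  \<comment> \<open>This part of \<open>\<bar>S (t n)\<bar>\<close> lies in the order interval
    controlled by \<open>f\<close>; the remainder is below \<open>\<bar>l n\<bar>\<close>.\<close>
  define w where "w n = inf \<bar>S (t n)\<bar> (T z)" for n
  have w: "w \<longlonglongrightarrow> 0"
  proof (rule f(3))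
    show w0: "0 \<le> w n" for n using T[OF z] by (simp add: w_def)
    show "w n \<le> T z" for n by (simp add: w_def)
    have "f (w n) \<le> f (T \<bar>t n\<bar>)" for n
      unfolding w_def by (intro f.mono le_infI1 St_le_Tt)
    then have upper: "\<forall>\<^sub>F n in sequentially. f (w n) \<le> f (T \<bar>t n\<bar>)" by simp
    have lower: "\<forall>\<^sub>F n in sequentially. 0 \<le> f (w n)" using f(2)[OF w0] by simp
    have "(\<lambda>n. f (T \<bar>t n\<bar>)) \<longlonglongrightarrow> 0"
      using null r(1) by (simp add: t_def)
    then show "(\<lambda>n. f (w n)) \<longlonglongrightarrow> 0"
      by (rule tendsto_sandwich[OF lower upper tendsto_const])
  qed
  have dominated: "norm (S (t n)) \<le> norm (w n) + norm (l n)" for n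
  proof -
    have "\<bar>S (t n)\<bar> - w n \<le> \<bar>l n\<bar>"
      unfolding w_def inf_eq_diff_pprt using St_le[of n]
      by (simp add: algebra_simps pprt_least)
    then have "\<bar>S (t n)\<bar> \<le> w n + \<bar>l n\<bar>" by (simp add: algebra_simps)
    then have "norm \<bar>S (t n)\<bar> \<le> norm (w n + \<bar>l n\<bar>)" by (intro norm_mono_nonneg) simp_all
    then show ?thesis using norm_triangle_ineq[of "w n" "\<bar>l n\<bar>"] by simp
  qed
  have "(\<lambda>n. norm (w n) + norm (l n)) \<longlonglongrightarrow> 0"
    using tendsto_add[OF tendsto_norm_zero[OF w] tendsto_norm_zero[OF l]] by simp
  then have "(\<lambda>n. S (t n)) \<longlonglongrightarrow> 0"
    by (rule Lim_null_comparison[OF always_eventually[OF allI[OF dominated]]])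
  moreover have "(\<lambda>n. S (t n)) = (\<lambda>n. (1 / real n) *\<^sub>R (\<Sum>k<n. S (x (a (b (r k))))))"
    unfolding t_def linear_scale[OF assms(3)] linear_sum[OF assms(3)] ..
  ultimately have "convergent (\<lambda>n. (1 / real n) *\<^sub>R (\<Sum>k<n. S (x (a (b (r k))))))"
    by (metis convergentI)
  moreover have "strict_mono (\<lambda>k. a (b (r k)))"
    using a(1) b r(1) by (simp add: strict_mono_def)
  ultimately show "\<exists>r :: nat \<Rightarrow> nat. strict_mono r \<and>
      convergent (\<lambda>n. (1 / real n) *\<^sub>R (\<Sum>k<n. S (x (r k))))"
    by (intro exI[of _ "\<lambda>k. a (b (r k))"] conjI)
qed

end
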